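(* Let $\mathbf{X}\in\mathbb{R}^{d\times n}$, $\mathbf{W}^\star\in\mathbb{R}^{m\times d}$ and $\mathbf{Y}=\mathbf{W}^\star\mathbf{X}$, and let $\mathbf{Y}=\sum_{k=1}^{r^\star}\sigma_k^\star\mathbf{u}_k^\star\mathbf{v}_k^{\star\top}$ be a singular value decomposition of $\mathbf{Y}$ with $r^\star=\operatorname{rank}(\mathbf{Y})$ and $\sigma_1^\star\ge\dots\ge\sigma_{r^\star}^\star>0$. For $1\le r'\le r^\star$ let $\mathbf{Y}^{(r')}:=\sum_{k=1}^{r'}\sigma_k^\star\mathbf{u}_k^\star\mathbf{v}_k^{\star\top}$. Let $1\le r\le r^\star$, let $\{(\mathbf{a}_k,\mathbf{b}_k)\}_{k=1}^r$ be the output of the Inexact Sequential Low-Rank procedure (described in the context) on $(\mathbf{X},\mathbf{Y})$ with target rank $r$, and let $\bm{\delta}_k$ be the corresponding numerical errors, with $\|\bm{\delta}_k\|_F>0$ for $k=1,\dots,r$ and $\|\bm{\delta}_0\|_F:=0$. Define $\mathcal{T}_k^\star:=\min\{\min_{k<j\le r^\star}|\sigma_k^\star-\sigma_j^\star|,\ \sigma_k^\star\}$ and $$E(k):=\sigma_{\max}(\mathbf{X})\sum_{k'=0}^{k-1}\|\bm{\delta}_{k'}\|_F\prod_{j=k'+1}^{k-1}\Big(\frac{6\sigma_j^\star}{\mathcal{T}_j^\star}+2\Big).$$ If $E(k)<\tfrac12\min_{k<j\le r^\star}|\sigma_k^\star-\sigma_j^\star|$ for every $k\in\{1,\dots,r\}$,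 then for any $r'$ with $r\le r'\le r^\star$, $$\Big\|\mathbf{Y}^{(r')}-\sum_{k=1}^r\mathbf{b}_k\mathbf{a}_k^\top\mathbf{X}\Big\|_F\le\sum_{k=r+1}^{r'}\sigma_k^\star+\sigma_{\max}(\mathbf{X})\sum_{k=1}^{r}\sum_{k'=0}^{k}\|\bm{\delta}_{k'}\|_F\prod_{j=k'+1}^{k}\Big(2+\frac{6\sigma_j^\star}{\mathcal{T}_k^\star}\Big).$$
   Context: $\sigma_{\max}(\mathbf{X})$ is the largest singular value of $\mathbf{X}$. Inexact Sequential Low-Rank procedure: $\mathbf{Y}_1:=\mathbf{Y}$; for $k=1,\dots,r$, vectors $\mathbf{a}_k\in\mathbb{R}^d,\mathbf{b}_k\in\mathbb{R}^m$ are produced by an arbitrary approximate rank-1 solver applied to $(\mathbf{Y}_k,\mathbf{X})$, and $\mathbf{Y}_{k+1}:=\mathbf{Y}_k-\mathbf{b}_k\mathbf{a}_k^\top\mathbf{X}$. Numerical error: $(\overline{\mathbf{a}}_k,\overline{\mathbf{b}}_k)\in\arg\min_{\mathbf{a}\in\mathbb{R}^d,\mathbf{b}\in\mathbb{R}^m}\tfrac12\|\mathbf{Y}_k-\mathbf{b}\mathbf{a}^\top\mathbf{X}\|_F^2$ and $\bm{\delta}_k:=\mathbf{b}_k\mathbf{a}_k^\top-\overline{\mathbf{b}}_k\overline{\mathbf{a}}_k^\top$. *)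

theory Defs
  imports "HOL-Analysis.Analysis"
begin

text \<open>Matrices are \<open>real^'c^'r\<close> (rows indexed by 'r, columns by 'c). The library norm on
  such matrices is the Euclidean norm of the vector of all entries, i.e. the Frobenius norm.\<close>

definition outer :: "real^'r \<Rightarrow> real^'c \<Rightarrow> real^'c^'r" where
  "outer b a = (\<chi> i j. b $ i * a $ j)"

definition sigma_max :: "real^'c^'r \<Rightarrow> real" where
  "sigma_max A = onorm (\<lambda>x. A *v x)"

definition is_svd :: "real^'n^'m \<Rightarrow> nat \<Rightarrow> (nat \<Rightarrow> real) \<Rightarrow> (nat \<Rightarrow> real^'m) \<Rightarrow> (nat \<Rightarrow> real^'n) \<Rightarrow> bool" where
  "is_svd Y rs \<sigma> u v \<longleftrightarrow>
     Y = (\<Sum>k=1..rs. \<sigma> k *\<^sub>R outer (u k) (v k)) \<and>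
     (\<forall>i\<in>{1..rs}. \<forall>j\<in>{1..rs}. u i \<bullet> u j = (if i = j then 1 else 0)) \<and>
     (\<forall>i\<in>{1..rs}. \<forall>j\<in>{1..rs}. v i \<bullet> v j = (if i = j then 1 else 0)) \<and>
     (\<forall>i\<in>{1..rs}. \<forall>j\<in>{1..rs}. i \<le> j \<longrightarrow> \<sigma> j \<le> \<sigma> i) \<and>
     (\<forall>i\<in>{1..rs}. \<sigma> i > 0)"

definition is_rank1_min :: "real^'n^'m \<Rightarrow> real^'n^'d \<Rightarrow> real^'d \<Rightarrow> real^'m \<Rightarrow> bool" where
  "is_rank1_min Yk X abar bbar \<longleftrightarrow>
     (\<forall>a b. (1/2) * (norm (Yk - outer bbar abar ** X))\<^sup>2 \<le> (1/2) * (norm (Yk - outer b a ** X))\<^sup>2)"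

text \<open>T*_k = min{ min_{k<j<=rs} |sigma_k - sigma_j|, sigma_k } (empty inner min = +infinity).\<close>
definition Tstar :: "(nat \<Rightarrow> real) \<Rightarrow> nat \<Rightarrow> nat \<Rightarrow> real" where
  "Tstar \<sigma> rs k = Min (insert (\<sigma> k) {\<bar>\<sigma> k - \<sigma> j\<bar> | j. k < j \<and> j \<le> rs})"

end

theory Submission
  imports Defs
begin

text \<open>Write \<open>Y\<^sub>k\<^sub>+\<^sub>1 = R\<^sub>k - \<delta>\<^sub>k X\<close>, where \<open>R\<^sub>k\<close> is \<open>Y\<^sub>k\<close> with its top singular triple \<open>(p\<^sub>k, q\<^sub>k)\<close> removed
  exactly. The right-hand side of the bound involves, for its last index, only the gap after
  \<open>\<sigma>\<^sub>r\<close>, so the \<open>r\<close> deflations must be treated as one block: small gaps inside the block are harmless.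
  With the contractions \<open>A = (1 - p\<^sub>r p\<^sub>r\<^sup>T) \<dots> (1 - p\<^sub>1 p\<^sub>1\<^sup>T)\<close> and
  \<open>C = (1 - q\<^sub>r q\<^sub>r\<^sup>T) \<dots> (1 - q\<^sub>1 q\<^sub>1\<^sup>T)\<close> one has \<open>A Y = R\<^sub>r C + E\<close> and \<open>Y C\<^sup>T = A\<^sup>T R\<^sub>r + E'\<close> with
  \<open>E\<close>, \<open>E'\<close> of norm at most the sum \<open>\<eta>\<close> of the norms of \<open>\<delta>\<^sub>1 X, \<dots>, \<delta>\<^sub>r\<^sub>-\<^sub>1 X\<close>.
  As the operator norm of \<open>R\<^sub>r\<close> is at most
  \<open>\<sigma>\<^sub>r\<^sub>+\<^sub>1 + \<eta>\<close>, a Wedin-type argument bounds \<open>A Y\<^sup>(\<^sup>r\<^sup>)\<close> and \<open>Y\<^sup>(\<^sup>r\<^sup>) C\<^sup>T\<close> by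
  \<open>2 \<eta> \<sigma>\<^sub>r / (\<sigma>\<^sub>r - \<sigma>\<^sub>r\<^sub>+\<^sub>1)\<close>, and three times this plus \<open>\<eta>\<close> bounds the distance from \<open>R\<^sub>r\<close> to
  \<open>Y - Y\<^sup>(\<^sup>r\<^sup>)\<close>. If \<open>r\<close> is the full rank there is no gap hypothesis; then \<open>R\<^sub>r\<close> itself is at most \<open>\<eta>\<close>,
  since exact deflation turns the distance to rank \<open>j + 1\<close> into the distance to rank \<open>j\<close>.\<close>

section \<open>Matrix algebra and Frobenius norm estimates\<close>

declare transpose_matrix_vector [simp del]

lemma inner_transpose_matrix:
  fixes A :: "real^'n^'m"
  shows "(transpose A *v x) \<bullet> y = x \<bullet> (A *v y)"
  by (simp add: transpose_matrix_vector dot_lmul_matrix)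

lemma transpose_diff:
  fixes A B :: "real^'n^'m"
  shows "transpose (A - B) = transpose A - transpose B"
  by (simp add: transpose_def vec_eq_iff)

lemma transpose_add:
  fixes A B :: "real^'n^'m"
  shows "transpose (A + B) = transpose A + transpose B"
  by (simp add: transpose_def vec_eq_iff)

lemma matrix_mul_diff_left:
  fixes A B :: "real^'n^'m" and C :: "real^'k^'n"
  shows "(A - B) ** C = A ** C - B ** C"
  by (simp add: matrix_eq matrix_vector_mul_assoc[symmetric] algebra_simps)

lemma matrix_mul_diff_right:
  fixes A :: "real^'n^'m" and B C :: "real^'k^'n"
  shows "A ** (B - C) = A ** B - A ** C"
  by (simp add: matrix_eq matrix_vector_mul_assoc[symmetric] algebra_simps)

lemma matrix_mul_add_left:
  fixes A B :: "real^'n^'m" and C :: "real^'k^'n"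
  shows "(A + B) ** C = A ** C + B ** C"
  by (simp add: matrix_eq matrix_vector_mul_assoc[symmetric] algebra_simps)

lemma outer_mult_vec: "outer b a *v x = (a \<bullet> x) *\<^sub>R b"
  by (simp add: outer_def matrix_vector_mult_def vec_eq_iff inner_vec_def sum_distrib_left
      mult_ac)

lemma transpose_outer: "transpose (outer b a) = outer a b"
  by (simp add: outer_def transpose_def vec_eq_iff)

lemma outer_matrix_mul: "outer b a ** X = outer b (transpose X *v a)"
  by (simp add: matrix_eq matrix_vector_mul_assoc[symmetric] outer_mult_vec inner_transpose_matrix)

lemma norm_sq_columns:
  fixes A :: "real^'n^'m"
  shows "(norm A)\<^sup>2 = (\<Sum>j\<in>UNIV. (norm (A *v axis j 1))\<^sup>2)"
proof -
  have "(norm A)\<^sup>2 = (\<Sum>i\<in>UNIV. \<Sum>j\<in>UNIV. (A $ i $ j)\<^sup>2)"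
    unfolding power2_norm_eq_inner by (simp add: inner_vec_def power2_eq_square)
  also have "\<dots> = (\<Sum>j\<in>UNIV. \<Sum>i\<in>UNIV. (A $ i $ j)\<^sup>2)"
    by (rule sum.swap)
  also have "\<dots> = (\<Sum>j\<in>UNIV. (norm (A *v axis j 1))\<^sup>2)"
    unfolding power2_norm_eq_inner
    by (simp add: inner_vec_def power2_eq_square matrix_vector_mult_basis column_def)
  finally show ?thesis .
qed

lemma norm_transpose:
  fixes A :: "real^'n^'m"
  shows "norm (transpose A) = norm A"
proof -
  have "(norm (transpose A))\<^sup>2 = (norm A)\<^sup>2"
    by (simp add: power2_norm_eq_inner inner_vec_def transpose_def sum.swap[of _ "UNIV::'n set"])
  then show ?thesis
    by simp
qed

lemma inner_outer:
  fixes A :: "real^'n^'m"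
  shows "A \<bullet> outer b a = b \<bullet> (A *v a)"
  by (simp add: inner_vec_def outer_def matrix_vector_mult_def sum_distrib_left mult_ac)

lemma norm_outer: "norm (outer b a) = norm b * norm a"
proof -
  have "(norm (outer b a))\<^sup>2 = (norm b * norm a)\<^sup>2"
    unfolding power2_norm_eq_inner power_mult_distrib
    by (simp add: inner_outer outer_mult_vec)
  then show ?thesis
    by simp
qed

text \<open>Applied to each column of \<open>N\<close> separately. This is the bridge by which
  pointwise vector estimates become Frobenius estimates for products.\<close>

lemma norm_matrix_mul_mono:
  fixes A :: "real^'n^'m" and B :: "real^'n^'p" and N :: "real^'k^'n"
  assumes "\<And>x. norm (A *v x) \<le> c * norm (B *v x)" "0 \<le> c"
  shows "norm (A ** N) \<le> c * norm (B ** N)"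
proof -
  have "(norm (A ** N))\<^sup>2 \<le> (\<Sum>j\<in>UNIV. (c * norm (B ** N *v axis j 1))\<^sup>2)"
    unfolding norm_sq_columns[of "A ** N"]
    by (intro sum_mono power_mono) (simp_all add: matrix_vector_mul_assoc[symmetric] assms)
  also have "\<dots> = (c * norm (B ** N))\<^sup>2"
    by (simp add: norm_sq_columns[of "B ** N"] power_mult_distrib sum_distrib_left)
  finally show ?thesis
    by (rule power2_le_imp_le) (simp add: assms(2))
qed

lemma norm_matrix_mul_le_left:
  fixes A :: "real^'n^'m" and N :: "real^'k^'n"
  assumes "\<And>x. norm (A *v x) \<le> c * norm x" "0 \<le> c"
  shows "norm (A ** N) \<le> c * norm N"
  using norm_matrix_mul_mono[of A c "mat 1" N] assms by simp

text \<open>Test the hypothesis at \<open>transpose A *v y\<close> itself and cancel one factor of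
  its norm.\<close>

lemma opnorm_transpose_le:
  fixes A :: "real^'n^'m"
  assumes "\<And>x. norm (A *v x) \<le> c * norm x"
  shows "norm (transpose A *v y) \<le> c * norm y"
proof (cases "transpose A *v y = 0")
  case True
  \<comment> \<open>A unit vector in the hypothesis yields \<open>0 \<le> c\<close>.\<close>
  have "0 \<le> c * norm (axis undefined 1 :: real^'n)"
    using assms[of "axis undefined 1"] norm_ge_zero order_trans by blast
  then show ?thesis
    using True by simp
next
  case False
  let ?z = "transpose A *v y"
  have "norm ?z * norm ?z = y \<bullet> (A *v ?z)"
    by (simp add: inner_transpose_matrix[symmetric] dot_square_norm power2_eq_square)
  also have "\<dots> \<le> norm y * norm (A *v ?z)"
    by (rule norm_cauchy_schwarz)
  also have "\<dots> \<le> norm y * (c * norm ?z)"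
    by (intro mult_left_mono assms) simp
  finally show ?thesis
    using False by (simp add: mult_ac)
qed

lemma norm_matrix_mul_le_right:
  fixes A :: "real^'k^'n" and N :: "real^'n^'m"
  assumes "\<And>x. norm (A *v x) \<le> c * norm x" "0 \<le> c"
  shows "norm (N ** A) \<le> c * norm N"
  using norm_matrix_mul_le_left[of "transpose A" c "transpose N"] opnorm_transpose_le assms
  by (metis matrix_transpose_mul norm_transpose)

lemma norm_matrix_mul_sigma_max:
  fixes X :: "real^'n^'d" and N :: "real^'d^'m"
  shows "norm (N ** X) \<le> sigma_max X * norm N"
  unfolding sigma_max_def
  by (intro norm_matrix_mul_le_right onorm onorm_pos_le) (auto simp: linear_linear)

lemma sigma_max_nonneg: "0 \<le> sigma_max X"
  unfolding sigma_max_def by (intro onorm_pos_le) (auto simp: linear_linear)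

subsection \<open>Orthogonal projections\<close>

definition is_proj :: "real^'n^'n \<Rightarrow> bool" where
  "is_proj P \<longleftrightarrow> transpose P = P \<and> P ** P = P"

lemma is_projD:
  assumes "is_proj P"
  shows "P *v (P *v x) = P *v x" "(P *v x) \<bullet> y = x \<bullet> (P *v y)"
  using assms inner_transpose_matrix[of P x y]
  by (simp_all add: is_proj_def matrix_vector_mul_assoc)

lemma is_proj_compl:
  assumes "is_proj P"
  shows "is_proj (mat 1 - P)"
  using assms by (simp add: is_proj_def transpose_diff matrix_mul_diff_left matrix_mul_diff_right)

lemma proj_pythagoras_vec:
  assumes "is_proj P"
  shows "(norm x)\<^sup>2 = (norm (P *v x))\<^sup>2 + (norm (x - P *v x))\<^sup>2"
proof -
  have "orthogonal (P *v x) (x - P *v x)"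
    by (simp add: orthogonal_def inner_diff_right is_projD(1)[OF assms] is_projD(2)[OF assms, of x])
  from norm_add_Pythagorean[OF this] show ?thesis
    by simp
qed

lemma proj_contraction:
  assumes "is_proj P"
  shows "norm (P *v x) \<le> norm x" "norm (x - P *v x) \<le> norm x"
  by (rule power2_le_imp_le; simp add: proj_pythagoras_vec[OF assms, of x])+

lemma proj_pythagoras:
  fixes N :: "real^'k^'n"
  assumes "is_proj P"
  shows "(norm N)\<^sup>2 = (norm (P ** N))\<^sup>2 + (norm ((mat 1 - P) ** N))\<^sup>2"
  unfolding norm_sq_columns sum.distrib[symmetric]
  by (intro sum.cong refl)
    (simp add: matrix_vector_mul_assoc[symmetric] matrix_vector_mult_diff_rdistrib
      proj_pythagoras_vec[OF assms, of "N *v _"])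

section \<open>Orthonormal families and the projections onto their spans\<close>

lemma sum_matrix_vector_mult: "(\<Sum>k\<in>I. f k) *v x = (\<Sum>k\<in>I. f k *v x)"
  for f :: "'i \<Rightarrow> real^'n^'m"
  by (induction I rule: infinite_finite_induct) (auto simp: algebra_simps)

text \<open>Indexed families let numbered singular vectors and a basis indexed by itself share one
  notion.\<close>

definition orthonormal_on :: "'i set \<Rightarrow> ('i \<Rightarrow> 'a::real_inner) \<Rightarrow> bool" where
  "orthonormal_on I w \<longleftrightarrow> finite I \<and> (\<forall>i\<in>I. \<forall>j\<in>I. w i \<bullet> w j = (if i = j then 1 else 0))"

lemma orthonormal_on_subset: "orthonormal_on I w \<Longrightarrow> J \<subseteq> I \<Longrightarrow> orthonormal_on J w"
  unfolding orthonormal_on_def using finite_subset by blast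

lemma orthonormal_inner_sum:
  assumes "orthonormal_on I w" "i \<in> I"
  shows "w i \<bullet> (\<Sum>k\<in>I. c k *\<^sub>R w k) = c i"
proof -
  have "w i \<bullet> (\<Sum>k\<in>I. c k *\<^sub>R w k) = (\<Sum>k\<in>I. if k = i then c k else 0)"
    unfolding inner_sum_right
    using assms by (intro sum.cong) (auto simp: orthonormal_on_def)
  then show ?thesis
    using assms by (simp add: orthonormal_on_def)
qed

lemma orthonormal_norm_sum_sq:
  assumes "orthonormal_on I w"
  shows "(norm (\<Sum>k\<in>I. c k *\<^sub>R w k))\<^sup>2 = (\<Sum>k\<in>I. (c k)\<^sup>2)"
  unfolding power2_norm_eq_inner inner_sum_left
  by (simp add: orthonormal_inner_sum[OF assms] power2_eq_square)

definition proj_on :: "'i set \<Rightarrow> ('i \<Rightarrow> real^'n) \<Rightarrow> real^'n^'n" where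
  "proj_on I w = (\<Sum>k\<in>I. outer (w k) (w k))"

lemma proj_on_mult_vec: "proj_on I w *v x = (\<Sum>k\<in>I. (w k \<bullet> x) *\<^sub>R w k)"
  by (simp add: proj_on_def sum_matrix_vector_mult outer_mult_vec)

lemma is_proj_proj_on:
  assumes "orthonormal_on I w"
  shows "is_proj (proj_on I w)"
proof -
  have "transpose (proj_on I w) = proj_on I w"
    by (simp add: proj_on_def transpose_def outer_def vec_eq_iff mult_ac)
  moreover have "proj_on I w ** proj_on I w = proj_on I w"
    by (simp add: matrix_eq matrix_vector_mul_assoc[symmetric] proj_on_mult_vec
        orthonormal_inner_sum[OF assms])
  ultimately show ?thesis
    by (simp add: is_proj_def)
qed

text \<open>The squared Frobenius norm of an orthogonal projection is its rank; ranks are later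
  compared through norms in this way.\<close>

lemma norm_proj_on:
  assumes "orthonormal_on I w"
  shows "(norm (proj_on I w))\<^sup>2 = real (card I)"
proof -
  have "(norm (proj_on I w))\<^sup>2 = (\<Sum>k\<in>I. w k \<bullet> (proj_on I w *v w k))"
  proof -
    have "P \<bullet> proj_on I w = (\<Sum>k\<in>I. w k \<bullet> (P *v w k))" for P
      by (simp add: proj_on_def inner_sum_right inner_outer)
    then show ?thesis
      unfolding power2_norm_eq_inner .
  qed
  also have "\<dots> = (\<Sum>k\<in>I. w k \<bullet> w k)"
  proof (rule sum.cong)
    fix k assume "k \<in> I"
    have "proj_on I w *v w k = (\<Sum>l\<in>I. if l = k then w l else 0)"
      unfolding proj_on_mult_vec
      using assms \<open>k \<in> I\<close> by (intro sum.cong) (auto simp: orthonormal_on_def)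
    then show "w k \<bullet> (proj_on I w *v w k) = w k \<bullet> w k"
      using assms \<open>k \<in> I\<close> by (simp add: orthonormal_on_def)
  qed simp
  also have "\<dots> = real (card I)"
    using assms by (simp add: orthonormal_on_def)
  finally show ?thesis .
qed

lemma is_proj_outer:
  assumes "norm p = 1"
  shows "is_proj (outer p p)"
  using is_proj_proj_on[of "{()}" "\<lambda>_. p"] assms
  by (simp add: orthonormal_on_def proj_on_def dot_square_norm)

text \<open>Meant for the computed left vectors, which may be neither orthogonal nor independent. An
  orthonormal basis of their span has at most as many elements, hence an inequality for the
  norm.\<close>

lemma obtain_projection_onto_span:
  fixes T :: "(real^'n) set"
  assumes "finite T"
  obtains P where "is_proj P" "(norm P)\<^sup>2 \<le> real (card T)" "\<And>x. x \<in> span T \<Longrightarrow> P *v x = x"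
proof -
  obtain B where B: "B \<subseteq> span T" "pairwise orthogonal B" "\<And>x. x \<in> B \<Longrightarrow> norm x = 1"
    "independent B" "card B = dim (span T)" "span B = span T"
    using orthonormal_basis_subspace[OF subspace_span[of T]] by metis
  have fin: "finite B"
    using B(4) by (rule independent_imp_finite)
  have on: "orthonormal_on B (\<lambda>b. b)"
    using B(2,3) fin by (auto simp: orthonormal_on_def pairwise_def orthogonal_def dot_square_norm)
  have "(norm (proj_on B (\<lambda>b. b)))\<^sup>2 \<le> real (card T)"
    using norm_proj_on[OF on] B(5) dim_le_card'[OF assms] by simp
  moreover have "proj_on B (\<lambda>b. b) *v x = x" if xT: "x \<in> span T" for x
  proof -
    obtain c where c: "x = (\<Sum>b\<in>B. c b *\<^sub>R b)"
      using xT span_finite[OF fin] B(6) by auto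
    show ?thesis
      unfolding proj_on_mult_vec c
      using orthonormal_inner_sum[OF on] by simp
  qed
  ultimately show ?thesis
    using that is_proj_proj_on[OF on] by blast
qed

subsection \<open>Top singular pairs and rank-one minimisers\<close>

definition top_pair :: "real^'n^'m \<Rightarrow> real^'m \<Rightarrow> real^'n \<Rightarrow> real \<Rightarrow> bool" where
  "top_pair M p q s \<longleftrightarrow> norm p = 1 \<and> norm q = 1 \<and> M *v q = s *\<^sub>R p \<and> transpose M *v p = s *\<^sub>R q \<and>
     (\<forall>x. norm (M *v x) \<le> s * norm x)"

text \<open>The equality case of the Cauchy-Schwarz inequality.\<close>

lemma eq_scaleR_of_inner_ge:
  fixes x p :: "'a::real_inner"
  assumes "norm p = 1" "norm x \<le> s" "p \<bullet> x = s"
  shows "x = s *\<^sub>R p"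
proof -
  have "(norm (x - s *\<^sub>R p))\<^sup>2 = (norm x)\<^sup>2 - s\<^sup>2"
    unfolding power2_norm_eq_inner using assms(1,3)
    by (simp add: norm_eq_1 inner_diff_left inner_diff_right inner_commute[of x p] power2_eq_square)
  also have "\<dots> \<le> 0"
    using assms(2) power_mono[of "norm x" s 2] by simp
  finally show ?thesis
    by simp
qed

text \<open>Attaining the operator norm in the bilinear form is equality in Cauchy-Schwarz for
  \<open>M\<close> and for its transpose, which gives both singular vector equations.\<close>

lemma top_pairI:
  assumes "norm p = 1" "norm q = 1" "p \<bullet> (M *v q) = s" "\<And>x. norm (M *v x) \<le> s * norm x"
  shows "top_pair M p q s"
proof -
  have "M *v q = s *\<^sub>R p"
    using assms(4)[of q] assms(1-3) by (intro eq_scaleR_of_inner_ge) auto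
  moreover have "transpose M *v p = s *\<^sub>R q"
    using opnorm_transpose_le[OF assms(4), of p] assms(1-3)
    by (intro eq_scaleR_of_inner_ge)
      (auto simp: inner_commute[of q] inner_transpose_matrix)
  ultimately show ?thesis
    using assms by (simp add: top_pair_def)
qed

lemma top_pair_exists:
  fixes M :: "real^'n^'m"
  obtains p q s where "top_pair M p q s"
proof -
  let ?S = "sphere (0::real^'n) 1"
  have "axis undefined 1 \<in> ?S"
    by simp
  then have "?S \<noteq> {}"
    by blast
  moreover have "continuous_on ?S (\<lambda>x. norm (M *v x))"
    by (intro continuous_intros)
  ultimately obtain q where q: "q \<in> ?S" "\<And>x. x \<in> ?S \<Longrightarrow> norm (M *v x) \<le> norm (M *v q)"
    using continuous_attains_sup[OF compact_sphere] by metis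
  define s where "s = norm (M *v q)"
  have bound: "norm (M *v x) \<le> s * norm x" for x
  proof (cases "x = 0")
    case False
    have "norm (M *v (x /\<^sub>R norm x)) \<le> s"
      unfolding s_def using False by (intro q(2)) simp
    then show ?thesis
      using False by (simp add: matrix_vector_mult_scaleR field_simps)
  qed simp
  \<comment> \<open>If \<open>s = 0\<close> then \<open>M\<close> vanishes, and any unit vector
    serves.\<close>
  define p where "p = (if s = 0 then axis undefined 1 else (M *v q) /\<^sub>R s)"
  have "norm p = 1"
    by (auto simp: p_def s_def)
  moreover have "p \<bullet> (M *v q) = s"
    by (auto simp: p_def s_def dot_square_norm power2_eq_square)
  ultimately show ?thesis
    using that top_pairI[of p q M s] bound q(1) by simp
qed

lemma norm_diff_outer_sq:
  fixes M :: "real^'n^'m"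
  shows "(norm (M - outer b g))\<^sup>2 = (norm M)\<^sup>2 - 2 * (b \<bullet> (M *v g)) + (norm b * norm g)\<^sup>2"
  unfolding norm_outer[symmetric] power2_norm_eq_inner
  by (simp add: inner_diff_left inner_diff_right inner_commute[of "outer b g" M] inner_outer[of M])

text \<open>The factorisation through \<open>X\<close> puts the top right singular vector into the
  row space of \<open>X\<close>, so the best unconstrained rank-one approximation is a competitor.
  Comparison with it forces equality in the operator norm bound, whence the minimiser is itself a
  top singular triple.\<close>

lemma rank1_min_top_pair:
  fixes V :: "real^'d^'m" and X :: "real^'n^'d"
  assumes M: "M = V ** X" and mn: "is_rank1_min M X a b"
  obtains p q s where "top_pair M p q s" "outer b a ** X = s *\<^sub>R outer p q"
proof -
  obtain p0 q0 s where tp: "top_pair M p0 q0 s"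
    by (rule top_pair_exists)
  define g where "g = transpose X *v a"
  have og: "outer b a ** X = outer b g"
    by (simp add: outer_matrix_mul g_def)
  have min: "(norm (M - outer b g))\<^sup>2 \<le> (norm (M - outer b' (transpose X *v a')))\<^sup>2" for a' b'
    using mn[unfolded is_rank1_min_def, rule_format, of b' a'] og by (simp add: outer_matrix_mul)
  have bound: "norm (M *v x) \<le> s * norm x" for x
    using tp by (simp add: top_pair_def)
  show ?thesis
  proof (cases "s = 0")
    case True
    have "M = 0"
      using bound True by (simp add: matrix_eq)
    moreover have "outer b g = 0"
      using min[of 0 0] \<open>M = 0\<close> norm_outer[of 0] norm_eq_zero[of "outer b g"]
      by (simp del: norm_eq_zero add: norm_outer)
    ultimately show ?thesis
      using that[of p0 q0 s] tp True og by simp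
  next
    case False
    have s: "0 < s"
      using False bound[of q0] tp norm_ge_zero[of "M *v q0"] by (auto simp: top_pair_def)
    \<comment> \<open>The competitor's \<open>a\<close> comes from
      \<open>transpose M *v p0 = s *\<^sub>R q0\<close>, where \<open>transpose M\<close> is
      \<open>transpose X ** transpose V\<close>.\<close>
    have "transpose X *v (transpose V *v p0 /\<^sub>R s) = q0"
      using tp s by (simp add: top_pair_def M matrix_transpose_mul matrix_vector_mul_assoc[symmetric]
          matrix_vector_mult_scaleR)
    then have "(norm (M - outer b g))\<^sup>2 \<le> (norm (M - outer (s *\<^sub>R p0) q0))\<^sup>2"
      using min by metis
    also have "\<dots> = (norm M)\<^sup>2 - s\<^sup>2"
      unfolding norm_diff_outer_sq using tp s
      by (simp add: top_pair_def dot_square_norm power2_eq_square)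
    finally have le: "(norm b * norm g)\<^sup>2 + s\<^sup>2 \<le> 2 * (b \<bullet> (M *v g))"
      unfolding norm_diff_outer_sq by simp
    have "b \<bullet> (M *v g) \<le> norm b * norm (M *v g)"
      by (rule norm_cauchy_schwarz)
    also have "\<dots> \<le> norm b * (s * norm g)"
      by (intro mult_left_mono bound) simp
    finally have cs: "b \<bullet> (M *v g) \<le> norm b * norm g * s"
      by (simp add: mult_ac)
    \<comment> \<open>Minimality bounds \<open>b \<bullet> (M *v g)\<close> from below,
      Cauchy-Schwarz from above; together they complete a square.\<close>
    have "(norm b * norm g - s)\<^sup>2 \<le> 0"
      using le cs unfolding power2_diff by linarith
    then have ng: "norm b * norm g = s"
      by simp
    have "b \<bullet> (M *v g) = s * s"
      using le cs unfolding ng by (simp add: power2_eq_square)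
    moreover have nz: "b \<noteq> 0" "g \<noteq> 0"
      using ng s by auto
    moreover have "(b /\<^sub>R norm b) \<bullet> (M *v (g /\<^sub>R norm g)) = (b \<bullet> (M *v g)) / (norm b * norm g)"
      by (simp add: matrix_vector_mult_scaleR divide_inverse mult_ac)
    ultimately have "top_pair M (b /\<^sub>R norm b) (g /\<^sub>R norm g) s"
      using ng s bound by (intro top_pairI) simp_all
    moreover have "outer b g = s *\<^sub>R outer (b /\<^sub>R norm b) (g /\<^sub>R norm g)"
      using nz by (simp add: matrix_eq scaleR_matrix_vector_assoc[symmetric] outer_mult_vec ng[symmetric])
        (simp add: field_simps)
    ultimately show ?thesis
      using that og by simp
  qed
qed

text \<open>Deflation is projection on either side alone, because \<open>M\<close> and its transpose
  exchange \<open>p\<close> and \<open>q\<close> up to the factor \<open>s\<close>.\<close>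

lemma top_pair_deflate:
  fixes M :: "real^'n^'m"
  assumes "top_pair M p q s"
  defines "M' \<equiv> M - s *\<^sub>R outer p q"
  shows "M' = (mat 1 - outer p p) ** M" "M' = M ** (mat 1 - outer q q)"
proof -
  have pq: "norm p = 1" "norm q = 1" "M *v q = s *\<^sub>R p" "transpose M *v p = s *\<^sub>R q"
    using assms(1) by (simp_all add: top_pair_def)
  have "p \<bullet> (M *v x) = s * (q \<bullet> x)" for x
    using inner_transpose_matrix[of M p x] pq by simp
  then show "M' = (mat 1 - outer p p) ** M"
    by (simp add: M'_def matrix_eq matrix_vector_mul_assoc[symmetric] matrix_vector_mult_diff_rdistrib
        scaleR_matrix_vector_assoc[symmetric] outer_mult_vec)
  show "M' = M ** (mat 1 - outer q q)"
    by (simp add: M'_def matrix_eq matrix_vector_mul_assoc[symmetric] matrix_vector_mult_diff_rdistrib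
        scaleR_matrix_vector_assoc[symmetric] outer_mult_vec matrix_vector_mult_diff_distrib
        matrix_vector_mult_scaleR pq mult_ac)
qed

text \<open>A Courant-Fischer argument: deflation lowers by one the codimension of a subspace on
  which the norm is at most \<open>t\<close>. If \<open>s \<le> t\<close> the whole space works;
  otherwise \<open>q\<close> lies outside \<open>W\<close> and is adjoined to it.\<close>

lemma deflate_opnorm_on_subspace:
  fixes M :: "real^'n^'m"
  assumes tp: "top_pair M p q s" and W: "subspace W" "CARD('n) \<le> dim W + Suc j"
    and bd: "\<And>x. x \<in> W \<Longrightarrow> norm (M *v x) \<le> t * norm x" and t: "0 \<le> t"
  obtains W' where "subspace W'" "CARD('n) \<le> dim W' + j"
    "\<And>x. x \<in> W' \<Longrightarrow> norm ((M - s *\<^sub>R outer p q) *v x) \<le> t * norm x"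
proof (cases "s \<le> t")
  case True
  have "norm ((M - s *\<^sub>R outer p q) *v x) \<le> t * norm x" for x
  proof -
    have "norm ((M - s *\<^sub>R outer p q) *v x) = norm (M *v (x - (q \<bullet> x) *\<^sub>R q))"
      unfolding top_pair_deflate(2)[OF tp]
      by (simp add: matrix_vector_mul_assoc[symmetric] matrix_vector_mult_diff_rdistrib outer_mult_vec)
    also have "\<dots> \<le> s * norm (x - (q \<bullet> x) *\<^sub>R q)"
      using tp by (simp add: top_pair_def)
    also have "\<dots> \<le> t * norm (x - outer q q *v x)"
      using True by (simp add: outer_mult_vec mult_right_mono)
    also have "\<dots> \<le> t * norm x"
      using tp t by (intro mult_left_mono proj_contraction is_proj_outer) (auto simp: top_pair_def)
    finally show ?thesis .
  qed
  then show ?thesis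
    using that[of UNIV] by simp
next
  case False
  have q: "norm q = 1" "M *v q = s *\<^sub>R p" "transpose M *v p = s *\<^sub>R q" "norm p = 1"
    using tp by (simp_all add: top_pair_def)
  have "q \<notin> W"
    using bd[of q] q False t by auto
  then have dim: "dim (insert q W) = dim W + 1"
    using W(1) by (simp add: dim_insert span_eq_iff[THEN iffD2])
  have "norm ((M - s *\<^sub>R outer p q) *v x) \<le> t * norm x" if x: "x \<in> span (insert q W)" for x
  proof -
    obtain c where "x - c *\<^sub>R q \<in> span W"
      using x by (auto simp: span_insert)
    define w where "w = x - c *\<^sub>R q"
    have "w \<in> W"
      using \<open>x - c *\<^sub>R q \<in> span W\<close> W(1) by (simp add: w_def span_eq_iff[THEN iffD2])
    define y where "y = w - (q \<bullet> w) *\<^sub>R q"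
    have yx: "y = x - outer q q *v x"
    proof -
      have "q \<bullet> w = q \<bullet> x - c"
        using q(1) by (simp add: w_def inner_diff_right dot_square_norm)
      then show ?thesis
        by (simp add: y_def w_def outer_mult_vec scaleR_diff_left)
    qed
    have qy: "q \<bullet> y = 0"
      using q(1) by (simp add: y_def inner_diff_right dot_square_norm)
    have "p \<bullet> (M *v y) = 0"
      using inner_transpose_matrix[of M p y] q qy by simp
    then have orth: "orthogonal ((q \<bullet> w) *\<^sub>R (s *\<^sub>R p)) (M *v y)"
      by (simp add: orthogonal_def)
    \<comment> \<open>Split \<open>w\<close> and \<open>M *v w\<close> along \<open>q\<close> and
      \<open>p\<close>. As \<open>s > t\<close>, the \<open>q\<close> part already exceeds its share
      of the bound, so the bound persists for the remaining part \<open>y\<close>.\<close>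
    have "M *v w = (q \<bullet> w) *\<^sub>R (s *\<^sub>R p) + M *v y"
      using q(2) by (simp add: y_def matrix_vector_mult_diff_distrib matrix_vector_mult_scaleR)
    then have 1: "(norm (M *v w))\<^sup>2 = (q \<bullet> w)\<^sup>2 * s\<^sup>2 + (norm (M *v y))\<^sup>2"
      using norm_add_Pythagorean[OF orth] q by (simp add: power_mult_distrib)
    have "(norm w)\<^sup>2 = (q \<bullet> w)\<^sup>2 + (norm y)\<^sup>2"
      using proj_pythagoras_vec[OF is_proj_outer[OF q(1)], of w] q(1)
      by (simp add: outer_mult_vec y_def)
    moreover have "(norm (M *v w))\<^sup>2 \<le> (t * norm w)\<^sup>2"
      using bd[OF \<open>w \<in> W\<close>] by (intro power_mono) auto
    ultimately have 2: "(norm (M *v w))\<^sup>2 \<le> (q \<bullet> w)\<^sup>2 * t\<^sup>2 + t\<^sup>2 * (norm y)\<^sup>2"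
      by (simp add: power_mult_distrib algebra_simps)
    have "(q \<bullet> w)\<^sup>2 * t\<^sup>2 \<le> (q \<bullet> w)\<^sup>2 * s\<^sup>2"
      using False t by (intro mult_left_mono power_mono) auto
    with 1 2 have "(norm (M *v y))\<^sup>2 \<le> (t * norm y)\<^sup>2"
      unfolding power_mult_distrib by linarith
    then have "norm (M *v y) \<le> t * norm y"
      using t by (auto intro: power2_le_imp_le[of _ "t * norm y"])
    also have "\<dots> \<le> t * norm x"
      unfolding yx using proj_contraction(2)[OF is_proj_outer[OF q(1)]] t by (rule mult_left_mono)
    finally show ?thesis
      unfolding top_pair_deflate(2)[OF tp] yx
      by (simp add: matrix_vector_mul_assoc[symmetric] matrix_vector_mult_diff_rdistrib)
  qed
  moreover have "CARD('n) \<le> dim (span (insert q W)) + j"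
    using W(2) dim by simp
  ultimately show ?thesis
    using that[OF subspace_span] by blast
qed

lemma norm_sq_split_direction:
  fixes B :: "real^'n^'m"
  assumes "norm d = 1"
  shows "(norm B)\<^sup>2 = (norm (B *v d))\<^sup>2 + (norm (B ** (mat 1 - outer d d)))\<^sup>2"
proof -
  have "outer d d ** transpose B = outer d (B *v d)"
    by (simp add: outer_matrix_mul)
  moreover have "(mat 1 - outer d d) ** transpose B = transpose (B ** (mat 1 - outer d d))"
    by (simp add: matrix_transpose_mul transpose_diff transpose_outer)
  ultimately show ?thesis
    using proj_pythagoras[OF is_proj_outer[OF assms], of "transpose B"] assms
    by (simp add: norm_transpose norm_outer)
qed

lemma norm_matrix_vector_le:
  fixes B :: "real^'n^'m"
  shows "norm (B *v x) \<le> norm B * norm x"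
proof (cases "x = 0")
  case False
  have "(norm (B *v (x /\<^sub>R norm x)))\<^sup>2 \<le> (norm B)\<^sup>2"
    using norm_sq_split_direction[of "x /\<^sub>R norm x" B] False by simp
  then have "norm (B *v (x /\<^sub>R norm x)) \<le> norm B"
    by (rule power2_le_imp_le) simp
  then show ?thesis
    using False by (simp add: matrix_vector_mult_scaleR field_simps)
qed simp

text \<open>Deflation decreases the Frobenius distance to matrices of bounded rank in step with the rank:
  rotating the row space of \<open>N\<close> so that only the direction \<open>d\<close> meets \<open>q\<close>, dropping \<open>d\<close> costs at most
  \<open>s\<^sup>2\<close>, which is exactly what deflation gains.\<close>

lemma deflate_frobenius_distance:
  fixes M N :: "real^'n^'m"
  assumes tp: "top_pair M p q s" and K: "subspace K" "CARD('n) \<le> dim K + Suc j"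
    and N: "\<And>x. x \<in> K \<Longrightarrow> N *v x = 0"
  obtains N' K' where "subspace K'" "CARD('n) \<le> dim K' + j" "\<And>x. x \<in> K' \<Longrightarrow> N' *v x = 0"
    "norm (M - s *\<^sub>R outer p q - N') \<le> norm (M - N)"
proof -
  note witness = that
  have q: "norm q = 1" "M *v q = s *\<^sub>R p" "norm p = 1" and bd: "\<And>x. norm (M *v x) \<le> s * norm x"
    using tp by (simp_all add: top_pair_def)
  have goal_N: "norm (M - s *\<^sub>R outer p q - N ** (mat 1 - outer d d)) \<le> norm (M - N)"
    if d: "norm d = 1" and Nq: "N *v q = (d \<bullet> q) *\<^sub>R (N *v d)" for d
  proof -
    let ?N = "N ** (mat 1 - outer d d)"
    have Nq0: "?N *v q = 0"
      using Nq by (simp add: matrix_vector_mul_assoc[symmetric] matrix_vector_mult_diff_rdistrib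
          outer_mult_vec matrix_vector_mult_diff_distrib matrix_vector_mult_scaleR)
    have Nd0: "?N *v d = 0"
      using d by (simp add: matrix_vector_mul_assoc[symmetric] matrix_vector_mult_diff_rdistrib
          outer_mult_vec dot_square_norm)
    have "?N ** outer q q = 0"
      using Nq0 by (simp add: matrix_eq matrix_vector_mul_assoc[symmetric] outer_mult_vec
          matrix_vector_mult_scaleR)
    then have "M - s *\<^sub>R outer p q - ?N = (M - ?N) ** (mat 1 - outer q q)"
      unfolding top_pair_deflate(2)[OF tp] by (simp add: matrix_mul_diff_left matrix_mul_diff_right)
    \<comment> \<open>Since \<open>?N\<close> annihilates \<open>q\<close>, the difference sends
      \<open>q\<close> to a vector of norm exactly \<open>s\<close>, and deflation removes this
      contribution.\<close>
    then have 1: "(norm (M - s *\<^sub>R outer p q - ?N))\<^sup>2 = (norm (M - ?N))\<^sup>2 - s\<^sup>2"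
      using norm_sq_split_direction[OF q(1), of "M - ?N"] q Nq0
      by (simp add: matrix_vector_mult_diff_rdistrib)
    have "outer d d ** outer d d = outer d d"
      using is_proj_outer[OF d] by (simp add: is_proj_def)
    then have "(M - ?N) ** (mat 1 - outer d d) = (M - N) ** (mat 1 - outer d d)"
      by (simp add: matrix_mul_diff_left matrix_mul_diff_right matrix_mul_assoc[symmetric])
    \<comment> \<open>The difference changes only in the direction \<open>d\<close>, where it
      becomes \<open>M *v d\<close>, of norm at most \<open>s\<close>.\<close>
    then have "(norm (M - ?N))\<^sup>2 = (norm (M *v d))\<^sup>2 + (norm ((M - N) ** (mat 1 - outer d d)))\<^sup>2"
      using norm_sq_split_direction[OF d, of "M - ?N"] Nd0
      by (simp add: matrix_vector_mult_diff_rdistrib)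
    moreover have "(norm (M *v d))\<^sup>2 \<le> s\<^sup>2"
      using bd[of d] d by (intro power_mono) auto
    moreover have "(norm ((M - N) ** (mat 1 - outer d d)))\<^sup>2 \<le> (norm (M - N))\<^sup>2"
      using norm_sq_split_direction[OF d, of "M - N"] by simp
    ultimately have "(norm (M - s *\<^sub>R outer p q - ?N))\<^sup>2 \<le> (norm (M - N))\<^sup>2"
      using 1 by linarith
    then show ?thesis
      by (rule power2_le_imp_le) simp
  qed
  have goal_K: ?thesis
    if d: "norm d = 1" and dK: "\<And>y. y \<in> K \<Longrightarrow> d \<bullet> y = 0" and Nq: "N *v q = (d \<bullet> q) *\<^sub>R (N *v d)" for d
  proof -
    have "d \<notin> K"
      using d dK[of d] by auto
    then have dim: "dim (insert d K) = dim K + 1"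
      using K(1) by (simp add: dim_insert span_eq_iff[THEN iffD2])
    have "(N ** (mat 1 - outer d d)) *v x = 0" if x: "x \<in> span (insert d K)" for x
    proof -
      obtain c where "x - c *\<^sub>R d \<in> span K"
        using x by (auto simp: span_insert)
      then have k: "x - c *\<^sub>R d \<in> K"
        using K(1) by (simp add: span_eq_iff[THEN iffD2])
      have "d \<bullet> x = c"
        using dK[OF k] d by (simp add: inner_diff_right dot_square_norm)
      then show ?thesis
        using N[OF k]
        by (simp add: matrix_vector_mul_assoc[symmetric] matrix_vector_mult_diff_rdistrib
          outer_mult_vec)
    qed
    moreover have "CARD('n) \<le> dim (span (insert d K)) + j"
      using K(2) dim by simp
    ultimately show ?thesis
      using witness[OF subspace_span _ _ goal_N[OF d Nq]] by blast
  qed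
  \<comment> \<open>The direction \<open>d\<close> is the normalised part of \<open>q\<close>
    orthogonal to \<open>K\<close>. If that part vanishes, \<open>N\<close> kills \<open>q\<close>,
    and any unit vector orthogonal to \<open>K\<close> will do.\<close>
  obtain y z where yz: "y \<in> span K" "\<And>w. w \<in> span K \<Longrightarrow> orthogonal z w" "q = y + z"
    by (rule orthogonal_subspace_decomp_exists[of K q]) blast
  have yK: "y \<in> K" and zK: "\<And>w. w \<in> K \<Longrightarrow> z \<bullet> w = 0"
    using yz(1,2) K(1) by (auto simp: span_eq_iff[THEN iffD2] orthogonal_def)
  show ?thesis
  proof (cases "z = 0")
    case False
    show ?thesis
    proof (rule goal_K[of "z /\<^sub>R norm z"])
      have "z \<bullet> q = norm z * norm z"
        using zK[OF yK] by (simp add: yz(3) inner_add_right dot_square_norm power2_eq_square)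
      moreover have "N *v q = N *v z"
        using N[OF yK] by (simp add: yz(3) matrix_vector_right_distrib)
      ultimately show "N *v q = ((z /\<^sub>R norm z) \<bullet> q) *\<^sub>R (N *v (z /\<^sub>R norm z))"
        using False by (simp add: matrix_vector_mult_scaleR field_simps)
    qed (use False zK in auto)
  next
    case True
    then have "q \<in> K"
      using yK yz(3) by simp
    show ?thesis
    proof (cases "dim K < CARD('n)")
      case True
      then obtain d where d: "d \<noteq> 0" "\<And>y. y \<in> span K \<Longrightarrow> orthogonal d y"
        using orthogonal_to_subspace_exists[of K] by auto
      have dK: "d \<bullet> y = 0" if "y \<in> K" for y
        using d(2)[of y] that by (simp add: span_base orthogonal_def)
      show ?thesis
        by (rule goal_K[of "d /\<^sub>R norm d"]) (use d(1) dK N \<open>q \<in> K\<close> in auto)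
    next
      case False
      \<comment> \<open>No direction is left to drop: \<open>N = 0\<close>, and deflation alone does
        not increase the norm.\<close>
      then have full: "dim K = CARD('n)"
        using dim_subset_UNIV_cart[of K] by simp
      then have "K = UNIV"
        using K(1) dim_eq_full[of K] by (simp add: span_eq_iff[THEN iffD2])
      then have "N = 0"
        using N by (simp add: matrix_eq)
      have "norm (M ** (mat 1 - outer q q)) \<le> norm M"
        using norm_sq_split_direction[OF q(1), of M] by (auto intro: power2_le_imp_le[of _ "norm M"])
      then show ?thesis
        using witness[of K 0] K(1) full \<open>N = 0\<close> top_pair_deflate(2)[OF tp] by simp
    qed
  qed
qed

subsection \<open>Inexact deflation\<close>

text \<open>Counting starts at 0: \<open>R k\<close> is the remainder after \<open>k\<close>
  deflations, and \<open>D k\<close> is the error made before the next one.\<close>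

locale inexact_deflation =
  fixes R D :: "nat \<Rightarrow> real^'n^'m" and p :: "nat \<Rightarrow> real^'m" and q :: "nat \<Rightarrow> real^'n"
    and s :: "nat \<Rightarrow> real" and r :: nat
  assumes top: "\<And>k. k < r \<Longrightarrow> top_pair (R k - D k) (p k) (q k) (s k)"
    and step: "\<And>k. k < r \<Longrightarrow> R (Suc k) = R k - D k - s k *\<^sub>R outer (p k) (q k)"
begin

text \<open>The sum stops before \<open>k\<close> because \<open>D k\<close> enters only after
  \<open>R k\<close> has been formed.\<close>

definition "\<eta> k = (\<Sum>l<k. norm (D l))"

lemma eta_nonneg: "0 \<le> \<eta> k"
  by (simp add: \<eta>_def sum_nonneg)

text \<open>A Weyl-type bound. The induction keeps a subspace of codimension at most
  \<open>r - k\<close> on which \<open>R k\<close> is bounded by \<open>t + \<eta> k\<close>; after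
  \<open>r\<close> deflations it is the whole space.\<close>

lemma opnorm_bound:
  assumes W: "subspace W" "CARD('n) \<le> dim W + r"
    and bd: "\<And>x. x \<in> W \<Longrightarrow> norm (R 0 *v x) \<le> t * norm x" and t: "0 \<le> t"
  shows "norm (R r *v x) \<le> (t + \<eta> r) * norm x"
proof -
  have "\<exists>W. subspace W \<and> CARD('n) \<le> dim W + (r - k) \<and>
      (\<forall>x\<in>W. norm (R k *v x) \<le> (t + \<eta> k) * norm x)" if "k \<le> r" for k
    using that
  proof (induction k)
    case 0
    then show ?case
      using W bd by (auto simp: \<eta>_def)
  next
    case (Suc k)
    then obtain V where V: "subspace V" "CARD('n) \<le> dim V + (r - k)"
      "\<And>x. x \<in> V \<Longrightarrow> norm (R k *v x) \<le> (t + \<eta> k) * norm x"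
      by auto
    have k: "k < r" "r - k = Suc (r - Suc k)"
      using Suc.prems by auto
    have "norm ((R k - D k) *v x) \<le> (t + \<eta> (Suc k)) * norm x" if "x \<in> V" for x
    proof -
      have "norm (D k *v x) \<le> norm (D k) * norm x"
        by (rule norm_matrix_vector_le)
      then show ?thesis
        using V(3)[OF that] norm_triangle_ineq4[of "R k *v x" "D k *v x"]
        by (simp add: \<eta>_def matrix_vector_mult_diff_rdistrib algebra_simps)
    qed
    then obtain V' where "subspace V'" "CARD('n) \<le> dim V' + (r - Suc k)"
      "\<And>x. x \<in> V' \<Longrightarrow> norm (R (Suc k) *v x) \<le> (t + \<eta> (Suc k)) * norm x"
      using deflate_opnorm_on_subspace[OF top[OF k(1)] V(1) V(2)[unfolded k(2)], of "t + \<eta> (Suc k)"]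
        t eta_nonneg[of "Suc k"] unfolding step[OF k(1)] by (metis add_nonneg_nonneg)
    then show ?case
      by blast
  qed
  from this[of r] obtain V where V: "subspace V" "CARD('n) \<le> dim V"
    "\<And>x. x \<in> V \<Longrightarrow> norm (R r *v x) \<le> (t + \<eta> r) * norm x"
    by auto
  have "dim V = CARD('n)"
    using V(2) dim_subset_UNIV_cart[of V] by simp
  then have "V = UNIV"
    using V(1) dim_eq_full[of V] by (simp add: span_eq_iff[THEN iffD2])
  then show ?thesis
    using V(3) by simp
qed

text \<open>The induction keeps a matrix \<open>N\<close> within \<open>\<eta> k\<close> of
  \<open>R k\<close> whose kernel has codimension at most \<open>r - k\<close>. It starts with
  \<open>R 0\<close> itself and ends with \<open>N = 0\<close>.\<close>

lemma frobenius_bound: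
  assumes K: "subspace K" "CARD('n) \<le> dim K + r" and R0: "\<And>x. x \<in> K \<Longrightarrow> R 0 *v x = 0"
  shows "norm (R r) \<le> \<eta> r"
proof -
  have "\<exists>K N. subspace K \<and> CARD('n) \<le> dim K + (r - k) \<and> (\<forall>x\<in>K. N *v x = 0) \<and>
      norm (R k - N) \<le> \<eta> k" if "k \<le> r" for k
    using that
  proof (induction k)
    case 0
    then show ?case
      using K R0 by (intro exI[of _ K] exI[of _ "R 0"]) (auto simp: \<eta>_def)
  next
    case (Suc k)
    then obtain K N where KN: "subspace K" "CARD('n) \<le> dim K + (r - k)"
      "\<And>x. x \<in> K \<Longrightarrow> N *v x = 0" "norm (R k - N) \<le> \<eta> k"
      by auto
    have k: "k < r" "r - k = Suc (r - Suc k)"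
      using Suc.prems by auto
    obtain N' K' where K': "subspace K'" "CARD('n) \<le> dim K' + (r - Suc k)"
      "\<And>x. x \<in> K' \<Longrightarrow> N' *v x = 0" and N': "norm (R (Suc k) - N') \<le> norm (R k - D k - N)"
      using deflate_frobenius_distance[OF top[OF k(1)] KN(1) KN(2)[unfolded k(2)] KN(3)]
      unfolding step[OF k(1)] by metis
    have "norm (R k - D k - N) \<le> norm (R k - N) + norm (D k)"
      using norm_triangle_ineq4[of "R k - N" "D k"] by (simp add: algebra_simps)
    then have "norm (R (Suc k) - N') \<le> \<eta> (Suc k)"
      using N' KN(4) by (simp add: \<eta>_def)
    then show ?case
      using K' by blast
  qed
  from this[of r] obtain K N where KN: "subspace K" "CARD('n) \<le> dim K"
    "\<And>x. x \<in> K \<Longrightarrow> N *v x = 0" "norm (R r - N) \<le> \<eta> r"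
    by auto
  have "dim K = CARD('n)"
    using KN(2) dim_subset_UNIV_cart[of K] by simp
  then have "K = UNIV"
    using KN(1) dim_eq_full[of K] by (simp add: span_eq_iff[THEN iffD2])
  then have "N = 0"
    using KN(3) by (simp add: matrix_eq)
  then show ?thesis
    using KN(4) by simp
qed

text \<open>Accumulating the deflating projectors in one contraction per side keeps every error term
  between two contractions, so no condition number of the computed singular vectors enters.\<close>

lemma accumulated_projectors:
  assumes "k \<le> r"
  shows "\<exists>A C E E' Z. (\<forall>x. norm (A *v x) \<le> norm x) \<and> (\<forall>x. norm (C *v x) \<le> norm x) \<and>
    (\<forall>x. x - A *v x \<in> span (p ` {..<k})) \<and>
    A ** R 0 = R k + Z \<and> A ** R 0 = R k ** C + E \<and>
    C ** transpose (R 0) = transpose (R k) ** A + E' \<and>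
    norm Z \<le> \<eta> k \<and> norm E \<le> \<eta> k \<and> norm E' \<le> \<eta> k"
  using assms
proof (induction k)
  case 0
  show ?case
    by (rule exI[of _ "mat 1"], rule exI[of _ "mat 1"], rule exI[of _ 0], rule exI[of _ 0],
        rule exI[of _ 0]) (simp add: \<eta>_def)
next
  case (Suc k)
  from Suc.IH[OF Suc_leD[OF Suc.prems]]
  obtain A C E E' Z where A: "\<And>x. norm (A *v x) \<le> norm x" "\<And>x. x - A *v x \<in> span (p ` {..<k})"
    and C: "\<And>x. norm (C *v x) \<le> norm x"
    and eqs: "A ** R 0 = R k + Z" "A ** R 0 = R k ** C + E"
      "C ** transpose (R 0) = transpose (R k) ** A + E'"
    and le: "norm Z \<le> \<eta> k" "norm E \<le> \<eta> k" "norm E' \<le> \<eta> k"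
    by blast
  have k: "k < r"
    using Suc.prems by auto
  define M P Q where "M = R k - D k" and "P = mat 1 - outer (p k) (p k)"
    and "Q = mat 1 - outer (q k) (q k)"
  have tp: "top_pair M (p k) (q k) (s k)" and R': "R (Suc k) = M - s k *\<^sub>R outer (p k) (q k)"
    using top[OF k] step[OF k] by (simp_all add: M_def)
  have RP: "R (Suc k) = P ** M" and RQ: "R (Suc k) = M ** Q"
    using top_pair_deflate[OF tp] R' by (simp_all add: P_def Q_def)
  have proj: "is_proj P" "is_proj Q"
    using tp by (auto simp: P_def Q_def top_pair_def intro!: is_proj_compl is_proj_outer)
  have sym: "transpose P = P" "transpose Q = Q" and idem: "P ** P = P" "Q ** Q = Q"
    using proj by (simp_all add: is_proj_def)
  have Rk: "R k = M + D k"
    by (simp add: M_def)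
  have cP: "norm (P ** N) \<le> norm N" for N :: "real^'z^'m"
    using norm_matrix_mul_le_left[of P 1 N] proj_contraction[OF proj(1)] by simp
  have cQ: "norm (Q ** N) \<le> norm N" for N :: "real^'z^'n"
    using norm_matrix_mul_le_left[of Q 1 N] proj_contraction[OF proj(2)] by simp
  \<comment> \<open>The new remainder absorbs its own projectors, so these can be inserted freely
    and attached to \<open>A\<close> and \<open>C\<close>.\<close>
  have RtP: "transpose (R (Suc k)) = transpose (R (Suc k)) ** P"
  proof -
    have "transpose (R (Suc k)) = transpose M ** P"
      by (simp add: RP matrix_transpose_mul sym)
    then show ?thesis
      by (metis idem(1) matrix_mul_assoc)
  qed
  have RtQ: "transpose (R (Suc k)) = Q ** transpose M"
    by (simp add: RQ matrix_transpose_mul sym)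
  have RQ': "R (Suc k) = R (Suc k) ** Q"
    by (metis RQ idem(2) matrix_mul_assoc)
  have e1: "(P ** A) ** R 0 = R (Suc k) + P ** (D k + Z)"
  proof -
    have "(P ** A) ** R 0 = P ** (M + (D k + Z))"
      by (simp add: matrix_mul_assoc[symmetric] eqs(1) Rk add.assoc)
    then show ?thesis
      by (simp add: matrix_add_ldistrib RP)
  qed
  have e2: "(P ** A) ** R 0 = R (Suc k) ** (Q ** C) + P ** (D k ** C + E)"
  proof -
    have "(P ** A) ** R 0 = P ** ((M + D k) ** C + E)"
      by (simp add: matrix_mul_assoc[symmetric] eqs(2) Rk)
    also have "\<dots> = (P ** M) ** C + P ** (D k ** C + E)"
      by (simp add: matrix_add_ldistrib matrix_mul_add_left matrix_mul_assoc add.assoc)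
    also have "(P ** M) ** C = (R (Suc k) ** Q) ** C"
      using RP RQ' by simp
    finally show ?thesis
      by (simp add: matrix_mul_assoc)
  qed
  have e3: "(Q ** C) ** transpose (R 0) =
      transpose (R (Suc k)) ** (P ** A) + Q ** (transpose (D k) ** A + E')"
  proof -
    have "(Q ** C) ** transpose (R 0) = Q ** ((transpose M + transpose (D k)) ** A + E')"
      by (simp add: matrix_mul_assoc[symmetric] eqs(3) Rk transpose_add)
    also have "\<dots> = (Q ** transpose M) ** A + Q ** (transpose (D k) ** A + E')"
      by (simp add: matrix_add_ldistrib matrix_mul_add_left matrix_mul_assoc add.assoc)
    also have "(Q ** transpose M) ** A = (transpose (R (Suc k)) ** P) ** A"
      using RtQ RtP by simp
    finally show ?thesis
      by (simp add: matrix_mul_assoc)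
  qed
  have n1: "norm (P ** (D k + Z)) \<le> \<eta> (Suc k)"
    using cP[of "D k + Z"] norm_triangle_ineq[of "D k" Z] le(1) by (simp add: \<eta>_def)
  have "norm (D k ** C) \<le> norm (D k)" "norm (transpose (D k) ** A) \<le> norm (D k)"
    using norm_matrix_mul_le_right[of C 1 "D k"] norm_matrix_mul_le_right[of A 1 "transpose (D k)"]
      A C by (simp_all add: norm_transpose)
  then have n2: "norm (P ** (D k ** C + E)) \<le> \<eta> (Suc k)"
    and n3: "norm (Q ** (transpose (D k) ** A + E')) \<le> \<eta> (Suc k)"
    using cP[of "D k ** C + E"] norm_triangle_ineq[of "D k ** C" E] le
      cQ[of "transpose (D k) ** A + E'"] norm_triangle_ineq[of "transpose (D k) ** A" E']
    by (simp_all add: \<eta>_def)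
  have cA': "norm ((P ** A) *v x) \<le> norm x" for x
    using proj_contraction(1)[OF proj(1), of "A *v x"] A(1)[of x]
    by (simp add: matrix_vector_mul_assoc[symmetric])
  have cC': "norm ((Q ** C) *v x) \<le> norm x" for x
    using proj_contraction(1)[OF proj(2), of "C *v x"] C[of x]
    by (simp add: matrix_vector_mul_assoc[symmetric])
  have sp: "x - (P ** A) *v x \<in> span (p ` {..<Suc k})" for x
  proof -
    have "x - A *v x \<in> span (p ` {..<Suc k})"
      using A(2)[of x] span_mono[of "p ` {..<k}" "p ` {..<Suc k}"] by (auto simp: lessThan_Suc)
    moreover have "(p k \<bullet> (A *v x)) *\<^sub>R p k \<in> span (p ` {..<Suc k})"
      by (intro span_scale span_base) simp
    moreover have "x - (P ** A) *v x = (x - A *v x) + (p k \<bullet> (A *v x)) *\<^sub>R p k"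
      by (simp add: P_def matrix_vector_mul_assoc[symmetric] matrix_vector_mult_diff_rdistrib
          outer_mult_vec)
    ultimately show ?thesis
      by (metis span_add)
  qed
  show ?case
    by (rule exI[of _ "P ** A"], rule exI[of _ "Q ** C"], rule exI[of _ "P ** (D k ** C + E)"],
        rule exI[of _ "Q ** (transpose (D k) ** A + E')"], rule exI[of _ "P ** (D k + Z)"],
        intro conjI allI cA' cC' sp e1 e2 e3 n1 n2 n3)
qed

end

subsection \<open>Perturbation of a block of singular vectors\<close>

text \<open>Restrict the relation to the range of \<open>Pv\<close>. There \<open>Y1\<close> is
  bounded below by \<open>\<sigma>\<close>, so \<open>C ** Pv\<close> is controlled by
  \<open>Y1 ** transpose C\<close>, while \<open>R\<close> contributes the factor
  \<open>\<rho>\<close>. It is applied to a matrix and to its transpose.\<close>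

lemma half_perturbation:
  fixes Y Y1 R E :: "real^'n^'m" and A :: "real^'m^'m" and C :: "real^'n^'n"
  assumes AE: "A ** Y = R ** C + E" and E: "norm E \<le> \<eta>"
    and R: "\<And>x. norm (R *v x) \<le> \<rho> * norm x" and \<rho>: "0 \<le> \<rho>" and \<sigma>: "0 < \<sigma>"
    and Pv: "is_proj Pv" and Y1: "Y1 = Y ** Pv"
    and low: "\<And>x. \<sigma> * norm (Pv *v x) \<le> norm (Y1 *v x)"
  shows "norm (A ** Y1) \<le> \<rho> / \<sigma> * norm (Y1 ** transpose C) + \<eta>"
proof -
  have "norm (Pv ** transpose C) \<le> 1 / \<sigma> * norm (Y1 ** transpose C)"
    using low \<sigma> by (intro norm_matrix_mul_mono) (simp_all add: field_simps)
  moreover have "norm (C ** Pv) = norm (Pv ** transpose C)"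
    using Pv norm_transpose[of "C ** Pv"] by (simp add: is_proj_def matrix_transpose_mul)
  ultimately have CP: "norm (C ** Pv) \<le> 1 / \<sigma> * norm (Y1 ** transpose C)"
    by simp
  have "A ** Y1 = R ** (C ** Pv) + E ** Pv"
    by (simp add: Y1 matrix_mul_assoc AE matrix_mul_add_left)
  then have "norm (A ** Y1) \<le> norm (R ** (C ** Pv)) + norm (E ** Pv)"
    by (simp add: norm_triangle_ineq)
  moreover have "norm (R ** (C ** Pv)) \<le> \<rho> * norm (C ** Pv)"
    using R \<rho> by (rule norm_matrix_mul_le_left)
  moreover have "\<rho> * norm (C ** Pv) \<le> \<rho> * (1 / \<sigma> * norm (Y1 ** transpose C))"
    using CP \<rho> by (rule mult_left_mono)
  moreover have "norm (E ** Pv) \<le> norm E"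
    using norm_matrix_mul_le_right[of Pv 1 E] proj_contraction[OF Pv] by simp
  ultimately show ?thesis
    using E by simp
qed

text \<open>Write \<open>R - S\<close> as \<open>A ** Y1 - (mat 1 - A) ** S - Z\<close>. With
  \<open>f\<close> the norm of the first term, the second is at most \<open>2 * f\<close> and the
  third at most \<open>\<eta>\<close>.\<close>

lemma block_perturbation:
  fixes Y Y1 R E Z :: "real^'n^'m" and A :: "real^'m^'m" and C :: "real^'n^'n"
  assumes A: "\<And>x. norm (A *v x) \<le> norm x" "\<And>x. x - A *v x \<in> span T" and T: "finite T"
    and AZ: "A ** Y = R + Z" and AE: "A ** Y = R ** C + E"
    and CE: "C ** transpose Y = transpose R ** A + E'"
    and le: "norm Z \<le> \<eta>" "norm E \<le> \<eta>" "norm E' \<le> \<eta>"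
    and R: "\<And>x. norm (R *v x) \<le> \<rho> * norm x" and \<rho>: "0 \<le> \<rho>" "\<rho> < \<sigma>"
    and proj: "is_proj Pu" "is_proj Pv" and card: "real (card T) \<le> (norm Pu)\<^sup>2"
    and Y1: "Y1 = Y ** Pv" "transpose Y1 = transpose Y ** Pu"
    and low: "\<And>x. \<sigma> * norm (Pv *v x) \<le> norm (Y1 *v x)"
      "\<And>x. \<sigma> * norm (Pu *v x) \<le> norm (transpose Y1 *v x)"
    and S: "S = Y - Y1" "\<And>x. norm (transpose S *v x) \<le> \<tau> * norm (x - Pu *v x)"
    and \<tau>: "0 \<le> \<tau>" "\<tau> \<le> \<sigma>"
  shows "norm (R - S) \<le> 3 * (\<eta> * \<sigma> / (\<sigma> - \<rho>)) + \<eta>"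
proof -
  have \<sigma>: "0 < \<sigma>"
    using \<rho> by simp
  \<comment> \<open>\<open>f\<close> and \<open>g\<close> measure how much of the leading block
    survives the left and the right contraction. Each bounds the other with factor
    \<open>\<rho> / \<sigma> < 1\<close> up to \<open>\<eta>\<close>, and the two inequalities are
    solved for \<open>f\<close>.\<close>
  define f g where "f = norm (A ** Y1)" and "g = norm (Y1 ** transpose C)"
  have fg: "f \<le> \<rho> / \<sigma> * g + \<eta>"
    unfolding f_def g_def by (rule half_perturbation[OF AE le(2) R \<rho>(1) \<sigma> proj(2) Y1(1) low(1)])
  have tr: "norm (C ** transpose Y1) = g" "norm (transpose Y1 ** transpose A) = f"
    using norm_transpose[of "Y1 ** transpose C"] norm_transpose[of "A ** Y1"]
    by (simp_all add: f_def g_def matrix_transpose_mul)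
  have gf: "g \<le> \<rho> / \<sigma> * f + \<eta>"
    using half_perturbation[OF CE le(3) opnorm_transpose_le[OF R] \<rho>(1) \<sigma> proj(1) Y1(2) low(2)]
    unfolding tr .
  have f: "f \<le> \<eta> * \<sigma> / (\<sigma> - \<rho>)"
  proof -
    have 1: "\<sigma> * f \<le> \<rho> * g + \<sigma> * \<eta>" "\<sigma> * g \<le> \<rho> * f + \<sigma> * \<eta>"
      using fg gf \<sigma> by (simp_all add: field_simps)
    have "\<sigma> * (\<sigma> * f) \<le> \<sigma> * (\<rho> * g + \<sigma> * \<eta>)"
      using 1(1) \<sigma> by simp
    moreover have "\<rho> * (\<sigma> * g) \<le> \<rho> * (\<rho> * f + \<sigma> * \<eta>)"
      using 1(2) \<rho>(1) by (rule mult_left_mono)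
    ultimately have "(\<sigma> + \<rho>) * ((\<sigma> - \<rho>) * f) \<le> (\<sigma> + \<rho>) * (\<eta> * \<sigma>)"
      by (simp add: algebra_simps)
    then have "(\<sigma> - \<rho>) * f \<le> \<eta> * \<sigma>"
      using \<rho>(1) \<sigma> by simp
    then show ?thesis
      using \<rho>(2) by (simp add: field_simps)
  qed
  obtain P where P: "is_proj P" "(norm P)\<^sup>2 \<le> real (card T)" "\<And>x. x \<in> span T \<Longrightarrow> P *v x = x"
    using obtain_projection_onto_span[OF T] by metis
  \<comment> \<open>\<open>A\<close> moves vectors only within the span of \<open>T\<close>, which
    \<open>P\<close> fixes; so \<open>A *v x\<close> and \<open>x\<close> have the same image under
    \<open>mat 1 - P\<close>.\<close>
  have fix_compl: "A *v x - P *v (A *v x) = x - P *v x" for x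
    using P(3)[OF A(2)[of x]] by (simp add: matrix_vector_mult_diff_distrib algebra_simps)
  \<comment> \<open>With equal images under \<open>mat 1 - P\<close>, contraction passes to the
    \<open>P\<close> components, and the triangle inequality gives the factor 2.\<close>
  have "norm (x - A *v x) \<le> 2 * norm (P *v x)" for x
  proof -
    have "(norm (P *v (A *v x)))\<^sup>2 \<le> (norm (P *v x))\<^sup>2"
      using proj_pythagoras_vec[OF P(1), of x] proj_pythagoras_vec[OF P(1), of "A *v x"]
        fix_compl[of x] power_mono[OF A(1)[of x], of 2] by simp
    then have "norm (P *v (A *v x)) \<le> norm (P *v x)"
      by (rule power2_le_imp_le) simp
    moreover have "x - A *v x = P *v x - P *v (A *v x)"
      using fix_compl[of x] by (simp add: algebra_simps)
    ultimately show ?thesis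
      using norm_triangle_ineq4[of "P *v x" "P *v (A *v x)"] by simp
  qed
  then have "norm ((mat 1 - A) ** S) \<le> 2 * norm (P ** S)"
    by (intro norm_matrix_mul_mono) (simp_all add: matrix_vector_mult_diff_rdistrib)
  moreover have "norm (P ** S) \<le> f"
  proof -
    have "norm (P ** S) = norm (transpose S ** P)"
      using norm_transpose[of "P ** S"] P(1) by (simp add: matrix_transpose_mul is_proj_def)
    also have "\<dots> \<le> \<tau> * norm ((mat 1 - Pu) ** P)"
      using S(2) \<tau>(1) by (intro norm_matrix_mul_mono) (simp_all add: matrix_vector_mult_diff_rdistrib)
    also have "\<dots> \<le> \<sigma> * norm ((mat 1 - Pu) ** P)"
      using \<tau>(2) by (intro mult_right_mono) auto
    \<comment> \<open>Here ranks matter: \<open>P\<close> has rank at most that of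
      \<open>Pu\<close>, and \<open>Pu ** P\<close> and \<open>P ** Pu\<close> have the same norm,
      so Pythagoras compares the complements.\<close>
    also have "\<dots> \<le> \<sigma> * norm ((mat 1 - P) ** Pu)"
    proof -
      have "(norm (Pu ** P))\<^sup>2 = (norm (P ** Pu))\<^sup>2"
        using norm_transpose[of "P ** Pu"] P(1) proj(1) by (simp add: matrix_transpose_mul is_proj_def)
      then have "(norm ((mat 1 - Pu) ** P))\<^sup>2 \<le> (norm ((mat 1 - P) ** Pu))\<^sup>2"
        using proj_pythagoras[OF proj(1), of P] proj_pythagoras[OF P(1), of Pu] P(2) card by linarith
      then have "norm ((mat 1 - Pu) ** P) \<le> norm ((mat 1 - P) ** Pu)"
        by (rule power2_le_imp_le) simp
      then show ?thesis
        using \<sigma> by simp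
    qed
    also have "\<dots> \<le> \<sigma> * norm (Pu ** transpose A)"
    proof -
      have "(mat 1 - P) ** Pu = (mat 1 - P) ** (A ** Pu)"
        by (simp add: matrix_eq matrix_vector_mul_assoc[symmetric] matrix_vector_mult_diff_rdistrib
            fix_compl)
      then have "norm ((mat 1 - P) ** Pu) \<le> norm (A ** Pu)"
        using norm_matrix_mul_le_left[of "mat 1 - P" 1 "A ** Pu"]
          proj_contraction[OF is_proj_compl[OF P(1)]] by simp
      moreover have "norm (A ** Pu) = norm (Pu ** transpose A)"
        using proj(1) norm_transpose[of "A ** Pu"] by (simp add: is_proj_def matrix_transpose_mul)
      ultimately show ?thesis
        using \<sigma> by simp
    qed
    also have "norm (Pu ** transpose A) \<le> 1 / \<sigma> * norm (transpose Y1 ** transpose A)"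
      using low(2) \<sigma> by (intro norm_matrix_mul_mono) (simp_all add: field_simps)
    finally show ?thesis
      using \<sigma> tr(2) by simp
  qed
  moreover have "R - S = A ** Y1 - (mat 1 - A) ** S - Z"
  proof -
    have "A ** Y1 + A ** S = R + Z"
      unfolding S(1) matrix_mul_diff_right AZ by simp
    then show ?thesis
      by (simp add: matrix_mul_diff_left algebra_simps)
  qed
  moreover have "norm (A ** Y1 - (mat 1 - A) ** S - Z) \<le>
      norm (A ** Y1) + norm ((mat 1 - A) ** S) + norm Z"
    by (meson add_mono norm_triangle_ineq4 order_trans order_refl)
  ultimately show ?thesis
    using f le(1) unfolding f_def by simp
qed

subsection \<open>Truncated singular value decompositions\<close>

text \<open>An arbitrary index set makes the full decomposition, its head and its tail instances of
  one object.\<close>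

definition svd_part :: "nat set \<Rightarrow> (nat \<Rightarrow> real) \<Rightarrow> (nat \<Rightarrow> real^'m) \<Rightarrow> (nat \<Rightarrow> real^'n) \<Rightarrow> real^'n^'m" where
  "svd_part I \<sigma> u v = (\<Sum>k\<in>I. \<sigma> k *\<^sub>R outer (u k) (v k))"

lemma svd_part_mult_vec: "svd_part I \<sigma> u v *v x = (\<Sum>k\<in>I. (\<sigma> k * (v k \<bullet> x)) *\<^sub>R u k)"
  by (simp add: svd_part_def sum_matrix_vector_mult scaleR_matrix_vector_assoc[symmetric]
      outer_mult_vec)

lemma transpose_svd_part: "transpose (svd_part I \<sigma> u v) = svd_part I \<sigma> v u"
  by (simp add: svd_part_def transpose_def outer_def vec_eq_iff mult_ac)

lemma svd_part_lower:
  assumes "orthonormal_on I u" "orthonormal_on I v" "\<And>k. k \<in> I \<Longrightarrow> c \<le> \<sigma> k" "0 \<le> c"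
  shows "c * norm (proj_on I v *v x) \<le> norm (svd_part I \<sigma> u v *v x)"
proof -
  have "(c * norm (proj_on I v *v x))\<^sup>2 = (\<Sum>k\<in>I. (c * (v k \<bullet> x))\<^sup>2)"
    unfolding power_mult_distrib proj_on_mult_vec orthonormal_norm_sum_sq[OF assms(2)]
    by (simp add: sum_distrib_left)
  also have "\<dots> \<le> (\<Sum>k\<in>I. (\<sigma> k * (v k \<bullet> x))\<^sup>2)"
    unfolding power_mult_distrib using assms(3,4) by (intro sum_mono mult_right_mono power_mono) auto
  also have "\<dots> = (norm (svd_part I \<sigma> u v *v x))\<^sup>2"
    unfolding svd_part_mult_vec orthonormal_norm_sum_sq[OF assms(1)] ..
  finally show ?thesis
    by (rule power2_le_imp_le) simp
qed

lemma svd_part_upper: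
  assumes "orthonormal_on I u" "orthonormal_on I v" "\<And>k. k \<in> I \<Longrightarrow> 0 \<le> \<sigma> k \<and> \<sigma> k \<le> c" "0 \<le> c"
  shows "norm (svd_part I \<sigma> u v *v x) \<le> c * norm (proj_on I v *v x)"
proof -
  have "(norm (svd_part I \<sigma> u v *v x))\<^sup>2 = (\<Sum>k\<in>I. (\<sigma> k * (v k \<bullet> x))\<^sup>2)"
    unfolding svd_part_mult_vec orthonormal_norm_sum_sq[OF assms(1)] ..
  also have "\<dots> \<le> (\<Sum>k\<in>I. (c * (v k \<bullet> x))\<^sup>2)"
    unfolding power_mult_distrib using assms(3,4) by (intro sum_mono mult_right_mono power_mono) auto
  also have "\<dots> = (c * norm (proj_on I v *v x))\<^sup>2"
    unfolding power_mult_distrib proj_on_mult_vec orthonormal_norm_sum_sq[OF assms(2)]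
    by (simp add: sum_distrib_left)
  finally show ?thesis
    by (rule power2_le_imp_le) (simp add: assms(4))
qed

lemma inner_proj_on:
  assumes "orthonormal_on I v" "J \<subseteq> I" "k \<in> I"
  shows "v k \<bullet> (proj_on J v *v x) = (if k \<in> J then v k \<bullet> x else 0)"
proof (cases "k \<in> J")
  case True
  then show ?thesis
    using orthonormal_inner_sum[OF orthonormal_on_subset[OF assms(1,2)] True]
    by (simp add: proj_on_mult_vec)
next
  case False
  have "v k \<bullet> (proj_on J v *v x) = (\<Sum>j\<in>J. 0)"
    unfolding proj_on_mult_vec inner_sum_right
  proof (rule sum.cong)
    fix j assume "j \<in> J"
    then have "v k \<bullet> v j = 0"
      using assms False unfolding orthonormal_on_def by (metis subsetD)
    then show "v k \<bullet> ((v j \<bullet> x) *\<^sub>R v j) = 0"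
      by simp
  qed simp
  then show ?thesis
    using False by simp
qed

lemma svd_part_mul_proj_on:
  assumes "orthonormal_on I v" "J \<subseteq> I"
  shows "svd_part I \<sigma> u v ** proj_on J v = svd_part J \<sigma> u v"
proof -
  have "svd_part I \<sigma> u v *v (proj_on J v *v x) = svd_part J \<sigma> u v *v x" for x
  proof -
    have "svd_part I \<sigma> u v *v (proj_on J v *v x) =
        (\<Sum>k\<in>I. if k \<in> J then (\<sigma> k * (v k \<bullet> x)) *\<^sub>R u k else 0)"
      unfolding svd_part_mult_vec
      using inner_proj_on[OF assms] by (intro sum.cong) auto
    also have "\<dots> = svd_part J \<sigma> u v *v x"
      unfolding svd_part_mult_vec using assms
      by (simp add: sum.inter_restrict[symmetric] orthonormal_on_def Int_absorb1)
    finally show ?thesis .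
  qed
  then show ?thesis
    by (simp add: matrix_eq matrix_vector_mul_assoc[symmetric])
qed

lemma svd_part_diff_upper:
  assumes "orthonormal_on I u" "orthonormal_on I v" "J \<subseteq> I"
    and "\<And>k. k \<in> I - J \<Longrightarrow> 0 \<le> \<sigma> k \<and> \<sigma> k \<le> c" "0 \<le> c"
  shows "norm ((svd_part I \<sigma> u v - svd_part J \<sigma> u v) *v x) \<le> c * norm (x - proj_on J v *v x)"
proof -
  let ?K = "I - J"
  have on: "orthonormal_on ?K u" "orthonormal_on ?K v"
    using assms(1,2) orthonormal_on_subset by blast+
  have fin: "finite I"
    using assms(1) by (simp add: orthonormal_on_def)
  have "svd_part I \<sigma> u v - svd_part J \<sigma> u v = svd_part ?K \<sigma> u v"
    unfolding svd_part_def by (rule sum_diff[OF fin assms(3), symmetric])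
  then have "norm ((svd_part I \<sigma> u v - svd_part J \<sigma> u v) *v x) \<le> c * norm (proj_on ?K v *v x)"
    using svd_part_upper[OF on assms(4,5)] by simp
  \<comment> \<open>The tail sees only what the head's projection leaves over.\<close>
  also have "proj_on ?K v *v x = proj_on ?K v *v (x - proj_on J v *v x)"
    unfolding proj_on_mult_vec[of ?K]
    by (intro sum.cong refl) (simp add: inner_diff_right inner_proj_on[OF assms(2,3)])
  also have "c * norm \<dots> \<le> c * norm (x - proj_on J v *v x)"
    using proj_contraction(1)[OF is_proj_proj_on[OF on(2)]] assms(5) by (rule mult_left_mono)
  finally show ?thesis .
qed

lemma dim_orthogonal_complement_ge:
  fixes v :: "nat \<Rightarrow> real^'n"
  assumes "finite I"
  shows "subspace {x. \<forall>k\<in>I. v k \<bullet> x = 0}" "CARD('n) \<le> dim {x. \<forall>k\<in>I. v k \<bullet> x = 0} + card I"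
proof -
  show "subspace {x. \<forall>k\<in>I. v k \<bullet> x = 0}"
    by (auto simp: subspace_def inner_add_right)
  have "{y \<in> UNIV. \<forall>x\<in>span (v ` I). orthogonal x y} \<subseteq> {x. \<forall>k\<in>I. v k \<bullet> x = 0}"
    by (auto simp: orthogonal_def intro: span_base)
  then have "dim {y \<in> UNIV. \<forall>x\<in>span (v ` I). orthogonal x y} \<le> dim {x. \<forall>k\<in>I. v k \<bullet> x = 0}"
    by (rule dim_subset)
  moreover have "dim (span (v ` I)) \<le> card I"
    using dim_le_card'[of "v ` I"] card_image_le[OF assms, of v] assms by simp
  moreover have "dim {y \<in> UNIV. \<forall>x\<in>span (v ` I). orthogonal x y} + dim (span (v ` I)) = CARD('n)"
    using dim_subspace_orthogonal_to_vectors[of "span (v ` I)" UNIV] by simp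
  ultimately show "CARD('n) \<le> dim {x. \<forall>k\<in>I. v k \<bullet> x = 0} + card I"
    by linarith
qed

lemma is_svd_orthonormal:
  assumes "is_svd Y rs \<sigma> u v"
  shows "orthonormal_on {1..rs} u" "orthonormal_on {1..rs} v" "Y = svd_part {1..rs} \<sigma> u v"
  using assms by (auto simp: is_svd_def orthonormal_on_def svd_part_def)

section \<open>Error of the remainder at full rank and at lower target rank\<close>

lemma (in inexact_deflation) deflation_error_full:
  assumes svd: "is_svd (R 0) r \<sigma> u v"
  shows "norm (R r) \<le> \<eta> r"
proof (rule frobenius_bound)
  let ?K = "{x. \<forall>k\<in>{1..r}. v k \<bullet> x = 0}"
  show "subspace ?K" "CARD('n) \<le> dim ?K + r"
    using dim_orthogonal_complement_ge[of "{1..r}" v] by simp_all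
  show "R 0 *v x = 0" if "x \<in> ?K" for x
    using that unfolding is_svd_orthonormal(3)[OF svd] svd_part_mult_vec by simp
qed

text \<open>\<open>block_perturbation\<close> with lower bound \<open>\<sigma> r\<close> on the
  head, \<open>\<tau> = \<sigma> (Suc r)\<close> on the tail and
  \<open>\<rho> = \<sigma> (Suc r) + \<eta> r\<close> for the remainder.\<close>

lemma (in inexact_deflation) deflation_error_truncated:
  assumes svd: "is_svd (R 0) rs \<sigma> u v" and r: "0 < r" "r < rs"
    and gap: "2 * \<eta> r < \<sigma> r - \<sigma> (Suc r)"
  shows "norm (R r - (R 0 - svd_part {1..r} \<sigma> u v)) \<le>
    (1 + 6 * \<sigma> r / (\<sigma> r - \<sigma> (Suc r))) * \<eta> r"
proof -
  let ?I = "{1..rs}" and ?J = "{1..r}"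
  define Y1 where "Y1 = svd_part ?J \<sigma> u v"
  have IJ: "?J \<subseteq> ?I"
    using r by auto
  note on = is_svd_orthonormal(1,2)[OF svd]
  have onJ: "orthonormal_on ?J u" "orthonormal_on ?J v"
    using on IJ orthonormal_on_subset by blast+
  have Y: "R 0 = svd_part ?I \<sigma> u v"
    by (rule is_svd_orthonormal(3)[OF svd])
  have mono: "\<sigma> j \<le> \<sigma> i" if "1 \<le> i" "i \<le> j" "j \<le> rs" for i j
    using svd that by (auto simp: is_svd_def)
  have pos: "0 < \<sigma> i" if "1 \<le> i" "i \<le> rs" for i
    using svd that by (auto simp: is_svd_def)
  have big: "\<sigma> r \<le> \<sigma> k" if "k \<in> ?J" for k
    using mono[of k r] that r by simp
  have small: "0 \<le> \<sigma> k \<and> \<sigma> k \<le> \<sigma> (Suc r)" if "k \<in> ?I - ?J" for k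
    using mono[of "Suc r" k] pos[of k] that r by (auto simp: less_imp_le)
  have \<tau>: "0 \<le> \<sigma> (Suc r)" "\<sigma> (Suc r) \<le> \<sigma> r"
    using pos[of "Suc r"] mono[of r "Suc r"] r by auto
  \<comment> \<open>On the orthogonal complement of the first \<open>r\<close> right singular
    vectors, \<open>R 0\<close> acts as the tail.\<close>
  have op: "norm (R r *v x) \<le> (\<sigma> (Suc r) + \<eta> r) * norm x" for x
  proof (rule opnorm_bound)
    let ?W = "{x. \<forall>k\<in>?J. v k \<bullet> x = 0}"
    show "subspace ?W" "CARD('n) \<le> dim ?W + r"
      using dim_orthogonal_complement_ge[of ?J v] by simp_all
    show "norm (R 0 *v x) \<le> \<sigma> (Suc r) * norm x" if "x \<in> ?W" for x
    proof -
      have "proj_on ?J v *v x = 0" "Y1 *v x = 0"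
        using that by (simp_all add: proj_on_mult_vec Y1_def svd_part_mult_vec)
      then show ?thesis
        using svd_part_diff_upper[OF on IJ _ \<tau>(1), of \<sigma> x, OF small]
        by (simp add: Y Y1_def matrix_vector_mult_diff_rdistrib)
    qed
  qed (rule \<tau>(1))
  obtain A C E E' Z where A: "\<And>x. norm (A *v x) \<le> norm x"
    "\<And>x. x - A *v x \<in> span (p ` {..<r})"
    and eqs: "A ** R 0 = R r + Z" "A ** R 0 = R r ** C + E"
      "C ** transpose (R 0) = transpose (R r) ** A + E'"
    and le: "norm Z \<le> \<eta> r" "norm E \<le> \<eta> r" "norm E' \<le> \<eta> r"
    using accumulated_projectors[of r] by blast
  have cardT: "real (card (p ` {..<r})) \<le> (norm (proj_on ?J u))\<^sup>2"
    using norm_proj_on[OF onJ(1)] card_image_le[of "{..<r}" p] by simp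
  have tY1: "transpose Y1 = svd_part ?J \<sigma> v u"
    by (simp add: Y1_def transpose_svd_part)
  have "norm (R r - (R 0 - Y1)) \<le>
      3 * (\<eta> r * \<sigma> r / (\<sigma> r - (\<sigma> (Suc r) + \<eta> r))) + \<eta> r"
  proof (rule block_perturbation[OF A _ eqs le op])
    show "Y1 = R 0 ** proj_on ?J v"
      unfolding Y Y1_def by (rule svd_part_mul_proj_on[OF on(2) IJ, symmetric])
    show "transpose Y1 = transpose (R 0) ** proj_on ?J u"
      unfolding Y tY1 transpose_svd_part by (rule svd_part_mul_proj_on[OF on(1) IJ, symmetric])
    show "\<sigma> r * norm (proj_on ?J v *v x) \<le> norm (Y1 *v x)" for x
      unfolding Y1_def using big pos[of r] r by (intro svd_part_lower onJ) auto
    show "\<sigma> r * norm (proj_on ?J u *v x) \<le> norm (transpose Y1 *v x)" for x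
      unfolding tY1 using big pos[of r] r by (intro svd_part_lower onJ) auto
    show "norm (transpose (R 0 - Y1) *v x) \<le> \<sigma> (Suc r) * norm (x - proj_on ?J u *v x)" for x
      unfolding transpose_diff tY1 Y transpose_svd_part
      by (rule svd_part_diff_upper[OF on(2,1) IJ small \<tau>(1)])
    show "0 \<le> \<sigma> (Suc r) + \<eta> r" "\<sigma> (Suc r) + \<eta> r < \<sigma> r"
      using \<tau>(1) eta_nonneg[of r] gap by auto
  qed (use cardT \<tau> is_proj_proj_on onJ in auto)
  \<comment> \<open>The hypothesis on \<open>\<eta> r\<close> leaves at least half the gap in the
    denominator, which turns 3 into 6.\<close>
  also have "\<dots> \<le> 3 * (\<eta> r * \<sigma> r / ((\<sigma> r - \<sigma> (Suc r)) / 2)) + \<eta> r"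
    using gap eta_nonneg[of r] pos[of r] r
    by (intro add_right_mono mult_left_mono divide_left_mono mult_nonneg_nonneg mult_pos_pos) auto
  also have "\<dots> = (1 + 6 * \<sigma> r / (\<sigma> r - \<sigma> (Suc r))) * \<eta> r"
    by (simp add: field_simps)
  finally show ?thesis
    by (simp add: Y1_def)
qed

section \<open>Singular value gaps and the final estimate\<close>

lemma Tstar_nonneg:
  assumes "0 \<le> \<sigma> k"
  shows "0 \<le> Tstar \<sigma> rs k"
proof -
  have "finite {\<bar>\<sigma> k - \<sigma> j\<bar> | j. k < j \<and> j \<le> rs}"
    by (rule finite_subset[of _ "(\<lambda>j. \<bar>\<sigma> k - \<sigma> j\<bar>) ` {..rs}"]) auto
  then show ?thesis
    using assms unfolding Tstar_def by (subst Min_ge_iff) auto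
qed

lemma Tstar_pos_le:
  assumes "k < rs" "0 < \<sigma> k" "\<And>j. k < j \<Longrightarrow> j \<le> rs \<Longrightarrow> \<sigma> j \<noteq> \<sigma> k"
  shows "0 < Tstar \<sigma> rs k" "Tstar \<sigma> rs k \<le> \<bar>\<sigma> k - \<sigma> (Suc k)\<bar>"
proof -
  have fin: "finite {\<bar>\<sigma> k - \<sigma> j\<bar> | j. k < j \<and> j \<le> rs}"
    by (rule finite_subset[of _ "(\<lambda>j. \<bar>\<sigma> k - \<sigma> j\<bar>) ` {..rs}"]) auto
  show "0 < Tstar \<sigma> rs k"
  proof -
    have "0 < \<bar>\<sigma> k - \<sigma> j\<bar>" if "k < j" "j \<le> rs" for j
      using assms(3)[OF that] by simp
    then show ?thesis
      using assms(2) fin unfolding Tstar_def by (subst Min_gr_iff) auto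
  qed
  show "Tstar \<sigma> rs k \<le> \<bar>\<sigma> k - \<sigma> (Suc k)\<bar>"
    unfolding Tstar_def using fin assms(1) by (intro Min_le) auto
qed

theorem theorem4:
  fixes X :: "real^'n^'d" and W :: "real^'d^'m" and Y :: "real^'n^'m"
    and rs r :: nat and \<sigma> :: "nat \<Rightarrow> real" and u :: "nat \<Rightarrow> real^'m" and v :: "nat \<Rightarrow> real^'n"
    and a abar :: "nat \<Rightarrow> real^'d" and b bbar :: "nat \<Rightarrow> real^'m"
    and Yk :: "nat \<Rightarrow> real^'n^'m" and \<delta> :: "nat \<Rightarrow> real^'d^'m"
    and dn :: "nat \<Rightarrow> real" and E :: "nat \<Rightarrow> real"
  assumes hY: "Y = W ** X"
    and hrank: "rs = rank Y"
    and hsvd: "is_svd Y rs \<sigma> u v"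
    and hr: "1 \<le> r" "r \<le> rs"
    and hY1: "Yk 1 = Y"
    and hYstep: "\<forall>k\<in>{1..r}. Yk (Suc k) = Yk k - outer (b k) (a k) ** X"
    and hmin: "\<forall>k\<in>{1..r}. is_rank1_min (Yk k) X (abar k) (bbar k)"
    and hdelta: "\<forall>k\<in>{1..r}. \<delta> k = outer (b k) (a k) - outer (bbar k) (abar k)"
    and hdpos: "\<forall>k\<in>{1..r}. norm (\<delta> k) > 0"
    and hdn: "\<forall>k. dn k = (if k = 0 then 0 else norm (\<delta> k))"
    and hE: "\<forall>k. E k = sigma_max X * (\<Sum>k'=0..k-1. dn k' *
                 (\<Prod>j=k'+1..k-1. 6 * \<sigma> j / Tstar \<sigma> rs j + 2))"
    and hcond: "\<forall>k\<in>{1..r}. \<forall>j. k < j \<and> j \<le> rs \<longrightarrow> E k < (1/2) * \<bar>\<sigma> k - \<sigma> j\<bar>"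
  shows "\<forall>r'. r \<le> r' \<and> r' \<le> rs \<longrightarrow>
    norm ((\<Sum>k=1..r'. \<sigma> k *\<^sub>R outer (u k) (v k)) - (\<Sum>k=1..r. outer (b k) (a k) ** X))
      \<le> (\<Sum>k=r+1..r'. \<sigma> k)
         + sigma_max X * (\<Sum>k=1..r. \<Sum>k'=0..k. dn k' *
              (\<Prod>j=k'+1..k. 2 + 6 * \<sigma> j / Tstar \<sigma> rs k))"
proof -
  define Y1 where "Y1 = svd_part {1..r} \<sigma> u v"
  \<comment> \<open>The values at 0 stand for an exact start, so that
    \<open>Yk (Suc k) = R k - D k\<close> holds from \<open>k = 0\<close> on.\<close>
  define R D where "R k = (if k = 0 then Y else Yk k - outer (bbar k) (abar k) ** X)"
    and "D k = (if k = 0 then 0 else \<delta> k ** X)" for k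
  have YR: "Yk (Suc k) = R k - D k" if "k \<le> r" for k
  proof (cases "k = 0")
    case True
    then show ?thesis
      using hY1 by (simp add: R_def D_def)
  next
    case False
    then show ?thesis
      using hYstep hdelta that by (simp add: R_def D_def matrix_mul_diff_left)
  qed
  \<comment> \<open>Every residual stays a multiple of \<open>X\<close>, as
    \<open>rank1_min_top_pair\<close> requires.\<close>
  have factor: "\<exists>V. Yk (Suc k) = V ** X" if "k \<le> r" for k
    using that
  proof (induction k)
    case 0
    then show ?case
      using hY hY1 by auto
  next
    case (Suc k)
    then obtain V where "Yk (Suc k) = V ** X"
      by auto
    then have "Yk (Suc (Suc k)) = (V - outer (b (Suc k)) (a (Suc k))) ** X"
      using hYstep Suc.prems by (simp add: matrix_mul_diff_left)
    then show ?case
      by blast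
  qed
  have "\<exists>p q s. top_pair (R k - D k) p q s \<and> R (Suc k) = R k - D k - s *\<^sub>R outer p q" if "k < r" for k
  proof -
    obtain V where "Yk (Suc k) = V ** X"
      using factor[of k] \<open>k < r\<close> by auto
    moreover have "is_rank1_min (Yk (Suc k)) X (abar (Suc k)) (bbar (Suc k))"
      using hmin \<open>k < r\<close> by auto
    ultimately obtain p q s where "top_pair (Yk (Suc k)) p q s"
      "outer (bbar (Suc k)) (abar (Suc k)) ** X = s *\<^sub>R outer p q"
      by (rule rank1_min_top_pair)
    then show ?thesis
      using YR[of k] \<open>k < r\<close> unfolding R_def[of "Suc k"] by auto
  qed
  then obtain p q s where pqs: "\<And>k. k < r \<Longrightarrow> top_pair (R k - D k) (p k) (q k) (s k)"
    "\<And>k. k < r \<Longrightarrow> R (Suc k) = R k - D k - s k *\<^sub>R outer (p k) (q k)"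
    by metis
  interpret inexact_deflation R D p q s r
    using pqs by unfold_locales
  have R0: "R 0 = Y"
    by (simp add: R_def)
  have svd: "is_svd (R 0) rs \<sigma> u v"
    using hsvd R0 by simp
  have pos: "0 < \<sigma> i" if "1 \<le> i" "i \<le> rs" for i
    using hsvd that by (auto simp: is_svd_def)
  have ratio: "0 \<le> \<sigma> i / Tstar \<sigma> rs k" if "1 \<le> i" "i \<le> rs" "1 \<le> k" "k \<le> rs" for i k
    using that pos by (intro divide_nonneg_nonneg Tstar_nonneg) (auto intro: less_imp_le)
  have dn0: "0 \<le> dn k" for k
    using hdn by simp
  have D_le: "norm (D k) \<le> sigma_max X * dn k" for k
    using hdn norm_matrix_mul_sigma_max[of "\<delta> k" X] by (simp add: D_def)
  have \<eta>_le: "\<eta> r \<le> sigma_max X * (\<Sum>k<r. dn k)"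
    unfolding \<eta>_def sum_distrib_left by (intro sum_mono D_le)
  \<comment> \<open>The constant 2 gives the bound the shape of the factor for \<open>j = r\<close>
    in the target.\<close>
  have core: "norm (R r - (Y - Y1)) \<le> (2 + 6 * \<sigma> r / Tstar \<sigma> rs r) * \<eta> r"
  proof (cases "r = rs")
    case True
    have "Y1 = Y"
      using is_svd_orthonormal(3)[OF hsvd] True by (simp add: Y1_def)
    then have "norm (R r - (Y - Y1)) \<le> 1 * \<eta> r"
      using deflation_error_full svd True by simp
    also have "\<dots> \<le> (2 + 6 * \<sigma> r / Tstar \<sigma> rs r) * \<eta> r"
      using ratio[of r r] hr eta_nonneg by (intro mult_right_mono) auto
    finally show ?thesis .
  next
    case False
    then have r: "r < rs"
      using hr by simp
    \<comment> \<open>All products in \<open>E r\<close> are at least 1, so \<open>E r\<close>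
      dominates the plain error sum and hence \<open>\<eta> r\<close>; this turns the hypothesis on
      \<open>E r\<close> into a gap condition.\<close>
    have "(\<Sum>k<r. dn k) \<le> (\<Sum>k'=0..r-1. dn k' * (\<Prod>j=k'+1..r-1. 6 * \<sigma> j / Tstar \<sigma> rs j + 2))"
    proof -
      have "(\<Sum>k<r. dn k) = (\<Sum>k=0..r-1. dn k * 1)"
        using hr by (intro sum.cong) auto
      also have "\<dots> \<le> (\<Sum>k'=0..r-1. dn k' * (\<Prod>j=k'+1..r-1. 6 * \<sigma> j / Tstar \<sigma> rs j + 2))"
      proof (intro sum_mono mult_left_mono prod_ge_1 dn0)
        fix k j assume "j \<in> {k + 1..r - 1}"
        then have "1 \<le> j" "j \<le> rs"
          using r by auto
        then show "1 \<le> 6 * \<sigma> j / Tstar \<sigma> rs j + 2"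
          using ratio[of j j] by simp
      qed
      finally show ?thesis .
    qed
    from mult_left_mono[OF this sigma_max_nonneg, of X] have "\<eta> r \<le> E r"
      using \<eta>_le hE[rule_format, of r] by linarith
    then have sep: "\<eta> r < 1/2 * \<bar>\<sigma> r - \<sigma> j\<bar>" if "r < j" "j \<le> rs" for j
      using hcond[rule_format, of r j] hr that by simp
    have ge: "\<sigma> (Suc r) \<le> \<sigma> r"
      using hsvd hr r by (auto simp: is_svd_def)
    have "2 * \<eta> r < \<sigma> r - \<sigma> (Suc r)"
      using sep[of "Suc r"] r ge by simp
    then have bound: "norm (R r - (Y - Y1)) \<le> (1 + 6 * \<sigma> r / (\<sigma> r - \<sigma> (Suc r))) * \<eta> r"
      using deflation_error_truncated[OF svd] hr r unfolding R0 Y1_def by simp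
    have T: "0 < Tstar \<sigma> rs r" "Tstar \<sigma> rs r \<le> \<sigma> r - \<sigma> (Suc r)"
    proof -
      have "\<sigma> j \<noteq> \<sigma> r" if "r < j" "j \<le> rs" for j
        using sep[OF that] eta_nonneg[of r] by auto
      then show "0 < Tstar \<sigma> rs r" "Tstar \<sigma> rs r \<le> \<sigma> r - \<sigma> (Suc r)"
        using Tstar_pos_le[of r rs \<sigma>] r pos[of r] hr ge by auto
    qed
    have "6 * \<sigma> r / (\<sigma> r - \<sigma> (Suc r)) \<le> 6 * \<sigma> r / Tstar \<sigma> rs r"
      using T pos[of r] hr by (intro divide_left_mono mult_pos_pos) auto
    then have "(1 + 6 * \<sigma> r / (\<sigma> r - \<sigma> (Suc r))) * \<eta> r \<le> (2 + 6 * \<sigma> r / Tstar \<sigma> rs r) * \<eta> r"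
      using eta_nonneg by (intro mult_right_mono) auto
    with bound show ?thesis
      by linarith
  qed
  define G where "G k = (\<Sum>k'=0..k. dn k' * (\<Prod>j=k'+1..k. 2 + 6 * \<sigma> j / Tstar \<sigma> rs k))" for k
  have ge2: "2 \<le> 2 + 6 * \<sigma> j / Tstar \<sigma> rs k" if "1 \<le> j" "j \<le> k" "k \<le> r" for j k
    using ratio[of j k] that hr by auto
  have "0 \<le> G k" if "k \<in> {1..r}" for k
    unfolding G_def
  proof (intro sum_nonneg mult_nonneg_nonneg prod_nonneg dn0 ballI)
    fix l j assume "j \<in> {l + 1..k}"
    then show "0 \<le> 2 + 6 * \<sigma> j / Tstar \<sigma> rs k"
      using ge2[of j k] that by auto
  qed
  \<comment> \<open>Only the summand \<open>k = r\<close> of the outer sum is kept; the others are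
    nonnegative.\<close>
  then have Gr: "G r \<le> (\<Sum>k=1..r. G k)"
    using hr by (intro member_le_sum) auto
  \<comment> \<open>In \<open>G r\<close> the index \<open>k' = r\<close> has an empty product. Each
    \<open>k' < r\<close> carries the factor for \<open>j = r\<close>, and its other factors are at
    least 1.\<close>
  have "dn r + (\<Sum>k<r. dn k * (2 + 6 * \<sigma> r / Tstar \<sigma> rs r)) \<le> G r"
  proof -
    have "dn k * (2 + 6 * \<sigma> r / Tstar \<sigma> rs r) \<le>
        dn k * (\<Prod>j=k+1..r. 2 + 6 * \<sigma> j / Tstar \<sigma> rs r)" if "k < r" for k
    proof (rule mult_left_mono[OF _ dn0])
      have "{k+1..r} = insert r {k+1..r-1}"
        using that by auto
      moreover have "1 \<le> (\<Prod>j=k+1..r-1. 2 + 6 * \<sigma> j / Tstar \<sigma> rs r)"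
      proof (rule prod_ge_1)
        fix j assume "j \<in> {k + 1..r - 1}"
        then show "1 \<le> 2 + 6 * \<sigma> j / Tstar \<sigma> rs r"
          using ge2[of j r] by auto
      qed
      moreover have "r \<notin> {k+1..r-1}"
        using hr by auto
      ultimately show "2 + 6 * \<sigma> r / Tstar \<sigma> rs r \<le> (\<Prod>j=k+1..r. 2 + 6 * \<sigma> j / Tstar \<sigma> rs r)"
        using ge2[of r r] hr mult_left_mono[of 1 _ "2 + 6 * \<sigma> r / Tstar \<sigma> rs r"] by simp
    qed
    moreover have "G r = (\<Sum>k<r. dn k * (\<Prod>j=k+1..r. 2 + 6 * \<sigma> j / Tstar \<sigma> rs r)) + dn r"
    proof -
      have "{0..r} = insert r {..<r}"
        by auto
      then show ?thesis
        by (simp add: G_def)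
    qed
    ultimately show ?thesis
      using sum_mono[of "{..<r}" "\<lambda>k. dn k * (2 + 6 * \<sigma> r / Tstar \<sigma> rs r)"] by simp
  qed
  with Gr have G: "dn r + (2 + 6 * \<sigma> r / Tstar \<sigma> rs r) * (\<Sum>k<r. dn k) \<le> (\<Sum>k=1..r. G k)"
    by (simp add: sum_distrib_right[symmetric] mult.commute)
  have partial: "(\<Sum>k=1..j. outer (b k) (a k) ** X) = Y - Yk (Suc j)" if "j \<le> r" for j
    using that hY1 hYstep by (induction j) auto
  \<comment> \<open>By telescoping the approximation is \<open>Y - Yk (Suc r)\<close>, and
    \<open>Yk (Suc r)\<close> is \<open>R r - D r\<close>; only here does the last error
    \<open>D r\<close> enter.\<close>
  have "Y1 - (\<Sum>k=1..r. outer (b k) (a k) ** X) = (R r - (Y - Y1)) - D r"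
    using partial[of r] YR[of r] by simp
  then have "norm (Y1 - (\<Sum>k=1..r. outer (b k) (a k) ** X)) \<le> norm (R r - (Y - Y1)) + norm (D r)"
    using norm_triangle_ineq4 by metis
  also have "\<dots> \<le> (2 + 6 * \<sigma> r / Tstar \<sigma> rs r) * (sigma_max X * (\<Sum>k<r. dn k)) + sigma_max X * dn r"
    using core D_le[of r] mult_left_mono[OF \<eta>_le, of "2 + 6 * \<sigma> r / Tstar \<sigma> rs r"] ge2[of r r] hr
    by linarith
  also have "\<dots> = sigma_max X * (dn r + (2 + 6 * \<sigma> r / Tstar \<sigma> rs r) * (\<Sum>k<r. dn k))"
    by (simp only: distrib_left mult_ac add.commute)
  also have "\<dots> \<le> sigma_max X * (\<Sum>k=1..r. G k)"
    using G sigma_max_nonneg by (rule mult_left_mono)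
  finally have main: "norm (Y1 - (\<Sum>k=1..r. outer (b k) (a k) ** X)) \<le> sigma_max X * (\<Sum>k=1..r. G k)" .
  show ?thesis
  proof (intro allI impI)
    fix r' assume r': "r \<le> r' \<and> r' \<le> rs"
    let ?B = "\<Sum>k=1..r. outer (b k) (a k) ** X" and ?t = "\<lambda>k. \<sigma> k *\<^sub>R outer (u k) (v k)"
    have "(\<Sum>k=1..r'. ?t k) = Y1 + (\<Sum>k=r+1..r'. ?t k)"
      unfolding Y1_def svd_part_def using r' hr sum.ub_add_nat[of 1 r ?t "r' - r"] by simp
    then have "norm ((\<Sum>k=1..r'. ?t k) - ?B) \<le> norm (\<Sum>k=r+1..r'. ?t k) + norm (Y1 - ?B)"
      using norm_triangle_ineq[of "\<Sum>k=r+1..r'. ?t k" "Y1 - ?B"] by (simp add: algebra_simps)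
    moreover have "norm (\<Sum>k=r+1..r'. ?t k) \<le> (\<Sum>k=r+1..r'. \<sigma> k)"
    proof (rule sum_norm_le)
      fix k assume "k \<in> {r+1..r'}"
      then have k: "k \<in> {1..rs}"
        using r' by auto
      then have "u k \<bullet> u k = 1" "v k \<bullet> v k = 1"
        using hsvd by (auto simp: is_svd_def)
      then show "norm (?t k) \<le> \<sigma> k"
        using pos[of k] k by (simp add: norm_outer norm_eq_1[symmetric])
    qed
    ultimately show "norm ((\<Sum>k=1..r'. ?t k) - ?B) \<le> (\<Sum>k=r+1..r'. \<sigma> k)
        + sigma_max X * (\<Sum>k=1..r. \<Sum>k'=0..k. dn k' * (\<Prod>j=k'+1..k. 2 + 6 * \<sigma> j / Tstar \<sigma> rs k))"
      using main unfolding G_def by linarith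
  qed
qed

end
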